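(* Let $\mathcal B$ be a BMDP such that $Q^*(q,a)<\infty$ for every type $q$ and every $a\in A(q)$, and consider the Q-learning process with learning rates $\lambda_i\in[0,1]$ satisfying $\sum_{i=0}^\infty\lambda_i=\infty$ and $\sum_{i=0}^\infty\lambda_i^2<\infty$, and a fixed selection distribution with $p_{q,a}\ge p_{\min}>0$ for all pairs. Then for every initial vector $Q_0\ge\mathbf 0$, almost surely $\lim_{i\to\infty}Q_i(q,a)=Q^*(q,a)$ for all pairs $(q,a)$; in particular $\lim_{i\to\infty}\min_{a\in A(q)}Q_i(q,a)=\mathbf c^*_q$ for every $q$.
   Context: A branching Markov decision process (BMDP) is a tuple $\mathcal B=(\mathcal T,A,p,c)$ where $\mathcal T$ is a finite set of types, $A$ is a finite set of actions, $p:\mathcal T\times A\to \mathrm{Dist}(\mathcal T^* )$ is a partial function assigning to some pairs $(q,a)$ a probability distribution with finite support over the set $\mathcal T^*$ of finite lists of types, and $c:\mathcal T\times A\to\mathbb R_{>0}$ is a strictly positive cost function. $A(q)$ is the (nonempty) set of $a$ with $p(q,a)$ defined. For a list $\alpha$, $|\alpha|$ is its length and $\alpha_i$ its $i$-th element. The BMDP induces an MDP on lists of entities: an action $(i,a)$ with $a\in A(\alpha_i)$ replaces entity $\alpha_i$ of the current list by a list $\beta$ drawn from $p(\alpha_i,a)$ at cost $c(\alpha_i,a)$; the empty list is absorbing with no cost. $\mathbf c^*_q\in[0,\infty]$ is the infimum over all (history-dependent, randomized) strategies of the expected total cost starting from the single entity $q$. Define $Q^*(q,a)=c(q,a)+\sum_{\alpha\in\mathcal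 T^*}p(q,a)(\alpha)\sum_{j=1}^{|\alpha|}\mathbf c^*_{\alpha_j}$ (so $\mathbf c^*_q=\min_{a\in A(q)}Q^*(q,a)$). Q-learning process for a BMDP: Q-values are vectors $Q$ indexed by pairs $(q,a)$ with $q\in\mathcal T$, $a\in A(q)$. Given deterministic learning rates $\lambda_i\in[0,1]$, a fixed probability distribution $(p_{q,a})$ over pairs and an initial vector $Q_0\ge\mathbf 0$, at each step $i$ a pair $(q_i,a_i)$ is selected with probability $p_{q_i,a_i}$ independently of all previous randomness, a list $\beta^i$ is drawn from $p(q_i,a_i)$ independently, and $Q_{i+1}(q_i,a_i)=(1-\lambda_i)Q_i(q_i,a_i)+\lambda_i\big(c(q_i,a_i)+\sum_{j=1}^{|\beta^i|}\min_{a'\in A(\beta^i_j)}Q_i(\beta^i_j,a')\big)$, all other entries unchanged. *)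

theory Defs
  imports "HOL-Probability.Probability"
begin

text \<open>A BMDP is given by: an action map A (A q = enabled actions of type q),
  a successor distribution p q a (a pmf over lists of types, meaningful for a in A q),
  and a cost function c.  Types 't and actions 'a range over finite types.\<close>

definition bmdp :: "('t::finite \<Rightarrow> 'a::finite set) \<Rightarrow> ('t \<Rightarrow> 'a \<Rightarrow> 't list pmf) \<Rightarrow> ('t \<Rightarrow> 'a \<Rightarrow> real) \<Rightarrow> bool" where
  "bmdp A p c \<longleftrightarrow> (\<forall>q. A q \<noteq> {}) \<and>
     (\<forall>q. \<forall>a\<in>A q. finite (set_pmf (p q a)) \<and> c q a > 0)"

text \<open>Histories: list of past (state, chosen action) pairs; the current state is passed separately.
  A (history-dependent, randomized) strategy maps a history and the current list of entities
  to a distribution over actions (i, a): rewrite entity number i (0-based) with action a.\<close>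

type_synonym ('t, 'a) hist = "('t list \<times> (nat \<times> 'a)) list"
type_synonym ('t, 'a) strategy = "('t, 'a) hist \<Rightarrow> 't list \<Rightarrow> (nat \<times> 'a) pmf"

definition valid_strategy :: "('t \<Rightarrow> 'a set) \<Rightarrow> ('t, 'a) strategy \<Rightarrow> bool" where
  "valid_strategy A \<sigma> \<longleftrightarrow>
     (\<forall>h \<alpha>. \<alpha> \<noteq> [] \<longrightarrow> set_pmf (\<sigma> h \<alpha>) \<subseteq> {(i, a). i < length \<alpha> \<and> a \<in> A (\<alpha> ! i)})"

primrec ecost :: "('t \<Rightarrow> 'a \<Rightarrow> 't list pmf) \<Rightarrow> ('t \<Rightarrow> 'a \<Rightarrow> real) \<Rightarrow> ('t, 'a) strategy
    \<Rightarrow> nat \<Rightarrow> ('t, 'a) hist \<Rightarrow> 't list \<Rightarrow> ennreal" where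
  "ecost p c \<sigma> 0 h \<alpha> = 0"
| "ecost p c \<sigma> (Suc n) h \<alpha> =
     (if \<alpha> = [] then 0 else
      \<integral>\<^sup>+ ia. (case ia of (i, a) \<Rightarrow>
          ennreal (c (\<alpha> ! i) a) +
          \<integral>\<^sup>+ \<beta>. ecost p c \<sigma> n (h @ [(\<alpha>, (i, a))]) (take i \<alpha> @ \<beta> @ drop (Suc i) \<alpha>)
            \<partial>measure_pmf (p (\<alpha> ! i) a))
        \<partial>measure_pmf (\<sigma> h \<alpha>))"

text \<open>Expected total cost (costs are nonnegative, so this is the limit of the expected
  costs of the first n steps, by monotone convergence).\<close>

definition total_cost :: "('t \<Rightarrow> 'a \<Rightarrow> 't list pmf) \<Rightarrow> ('t \<Rightarrow> 'a \<Rightarrow> real) \<Rightarrow> ('t, 'a) strategy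
    \<Rightarrow> 't list \<Rightarrow> ennreal" where
  "total_cost p c \<sigma> \<alpha> = (SUP n. ecost p c \<sigma> n [] \<alpha>)"

definition opt_cost :: "('t \<Rightarrow> 'a set) \<Rightarrow> ('t \<Rightarrow> 'a \<Rightarrow> 't list pmf) \<Rightarrow> ('t \<Rightarrow> 'a \<Rightarrow> real)
    \<Rightarrow> 't \<Rightarrow> ennreal" where
  "opt_cost A p c q = (INF \<sigma> \<in> {\<sigma>. valid_strategy A \<sigma>}. total_cost p c \<sigma> [q])"

definition Qstar :: "('t \<Rightarrow> 'a set) \<Rightarrow> ('t \<Rightarrow> 'a \<Rightarrow> 't list pmf) \<Rightarrow> ('t \<Rightarrow> 'a \<Rightarrow> real)
    \<Rightarrow> 't \<Rightarrow> 'a \<Rightarrow> ennreal" where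
  "Qstar A p c q a = ennreal (c q a) +
     \<integral>\<^sup>+ \<beta>. (\<Sum>x\<leftarrow>\<beta>. opt_cost A p c x) \<partial>measure_pmf (p q a)"

text \<open>Distribution of one Q-learning sample: a pair (q,a) drawn from sel, then a list beta
  drawn from p q a.  The samples of the successive steps are i.i.d.\<close>

definition sample_pmf :: "('t \<times> 'a) pmf \<Rightarrow> ('t \<Rightarrow> 'a \<Rightarrow> 't list pmf) \<Rightarrow> (('t \<times> 'a) \<times> 't list) pmf" where
  "sample_pmf sel p = bind_pmf sel (\<lambda>qa. map_pmf (\<lambda>\<beta>. (qa, \<beta>)) (p (fst qa) (snd qa)))"

primrec qlearn :: "('t \<Rightarrow> 'a set) \<Rightarrow> ('t \<Rightarrow> 'a \<Rightarrow> real) \<Rightarrow> (nat \<Rightarrow> real) \<Rightarrow> ('t \<times> 'a \<Rightarrow> real)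
    \<Rightarrow> (('t \<times> 'a) \<times> 't list) stream \<Rightarrow> nat \<Rightarrow> ('t \<times> 'a \<Rightarrow> real)" where
  "qlearn A c lr Q0 \<omega> 0 = Q0"
| "qlearn A c lr Q0 \<omega> (Suc i) =
     (case \<omega> !! i of (qa, \<beta>) \<Rightarrow>
        (qlearn A c lr Q0 \<omega> i)(qa :=
           (1 - lr i) * qlearn A c lr Q0 \<omega> i qa +
           lr i * (c (fst qa) (snd qa) +
             (\<Sum>b\<leftarrow>\<beta>. Min ((\<lambda>a'. qlearn A c lr Q0 \<omega> i (b, a')) ` A b)))))"

end

theory Submission
  imports Defs
begin

text \<open>
  The optimal cost is the limit of value iteration started at \<open>0\<close>: the greedy strategy that always
  rewrites the first entity attains this limit, and no strategy beats it because every step costs at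
  least some fixed \<open>m > 0\<close>. Hence the optimal cost solves the Bellman equation
  \<open>cs q = Min\<^sub>a Qs (q, a)\<close>.

  The Bellman operator \<open>T\<close> need not be a contraction, but since \<open>Qs - T 0\<close> is the expected cost of the
  offspring and \<open>T 0 = c > 0\<close>, it satisfies \<open>\<parallel>T Q - Qs\<parallel> \<le> \<kappa> \<parallel>Q - Qs\<parallel>\<close> with \<open>\<kappa> < 1\<close> for all \<open>Q \<ge> 0\<close>
  in the maximum norm weighted by \<open>Qs\<close>. For an even \<open>n\<close> with \<open>\<kappa>\<^sup>n \<le> pmin / 2\<close>, the sum \<open>V\<close> of the
  \<open>n\<close>-th powers of the relative errors \<open>Q / Qs - 1\<close> is a Lyapunov function: convexity of \<open>t\<^sup>n\<close> bounds
  its drift in a step of size \<open>l\<close> by \<open>- pmin / 2 * l * V + O(l\<^sup>2 * (1 + V))\<close>. So the expectation of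
  \<open>V\<close> tends to \<open>0\<close>, and as \<open>V\<close> plus a vanishing tail is eventually a supermartingale, Ville's maximal
  inequality turns this into almost sure convergence.
\<close>

subsection \<open>The Bellman equation for the optimal cost\<close>

definition qval :: "('t \<Rightarrow> 'a \<Rightarrow> 't list pmf) \<Rightarrow> ('t \<Rightarrow> 'a \<Rightarrow> real) \<Rightarrow> ('t \<Rightarrow> ennreal) \<Rightarrow> 't \<Rightarrow> 'a \<Rightarrow> ennreal" where
  "qval p c v q a = ennreal (c q a) + (\<integral>\<^sup>+ \<beta>. (\<Sum>x\<leftarrow>\<beta>. v x) \<partial>measure_pmf (p q a))"

definition bellman :: "('t \<Rightarrow> 'a set) \<Rightarrow> ('t \<Rightarrow> 'a \<Rightarrow> 't list pmf) \<Rightarrow> ('t \<Rightarrow> 'a \<Rightarrow> real) \<Rightarrow> ('t \<Rightarrow> ennreal) \<Rightarrow> 't \<Rightarrow> ennreal" where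
  "bellman A p c v q = (INF a\<in>A q. qval p c v q a)"

lemma sum_list_mono_ennreal: "v \<le> w \<Longrightarrow> (\<Sum>x\<leftarrow>\<beta>. v x) \<le> (\<Sum>x\<leftarrow>\<beta>. w x :: ennreal)"
  by (intro sum_list_mono) (simp add: le_fun_def)

lemma qval_mono: "v \<le> w \<Longrightarrow> qval p c v q a \<le> qval p c w q a"
  unfolding qval_def by (intro add_left_mono nn_integral_mono sum_list_mono_ennreal)

lemma bellman_mono: "v \<le> w \<Longrightarrow> bellman A p c v \<le> bellman A p c w"
  unfolding bellman_def by (auto simp: le_fun_def intro!: INF_mono' qval_mono)

lemma SUP_sum_list_ennreal:
  fixes v :: "nat \<Rightarrow> 't \<Rightarrow> ennreal"
  assumes "incseq v"
  shows "(\<Sum>x\<leftarrow>\<beta>. SUP k. v k x) = (SUP k. \<Sum>x\<leftarrow>\<beta>. v k x)"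
proof (induction \<beta>)
  case (Cons y \<beta>)
  have "incseq (\<lambda>k. v k y)" "incseq (\<lambda>k. \<Sum>x\<leftarrow>\<beta>. v k x)"
    using assms by (auto simp: incseq_def le_fun_def intro!: sum_list_mono)
  then show ?case
    by (simp add: Cons ennreal_SUP_add)
qed (simp add: bot_ennreal)

text \<open>Monotone convergence, first through the list sums and then through the integral. It lets
  a bound on \<open>qval\<close> of every iterate pass to the limit of value iteration.\<close>

lemma SUP_qval:
  assumes "incseq v"
  shows "qval p c (\<lambda>x. SUP k. v k x) q a = (SUP k. qval p c (v k) q a)"
proof -
  have "incseq (\<lambda>k \<beta>. \<Sum>x\<leftarrow>\<beta>. v k x)"
    using assms by (auto simp: incseq_def le_fun_def intro!: sum_list_mono)
  then have "(\<integral>\<^sup>+ \<beta>. (\<Sum>x\<leftarrow>\<beta>. SUP k. v k x) \<partial>measure_pmf (p q a)) =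
      (SUP k. \<integral>\<^sup>+ \<beta>. (\<Sum>x\<leftarrow>\<beta>. v k x) \<partial>measure_pmf (p q a))"
    unfolding SUP_sum_list_ennreal[OF assms]
    by (intro nn_integral_monotone_convergence_SUP) auto
  then show ?thesis
    unfolding qval_def by (simp add: ennreal_SUP_add_right)
qed

lemma nn_integral_pmf_ge:
  fixes f :: "'b \<Rightarrow> ennreal"
  assumes "\<And>x. x \<in> set_pmf M \<Longrightarrow> k \<le> f x"
  shows "k \<le> (\<integral>\<^sup>+x. f x \<partial>measure_pmf M)"
proof -
  have "k = (\<integral>\<^sup>+x. k \<partial>measure_pmf M)"
    by (simp add: measure_pmf.emeasure_space_1[simplified])
  also have "\<dots> \<le> (\<integral>\<^sup>+x. f x \<partial>measure_pmf M)"
    using assms by (intro nn_integral_mono_AE AE_pmfI)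
  finally show ?thesis .
qed

section \<open>Expected costs of a strategy and their one-step recursion\<close>

lemma ecost_Nil [simp]: "ecost p c \<sigma> n h [] = 0"
  by (cases n) auto

text \<open>Keeping the continuation \<open>F\<close> abstract lets the finite-horizon costs and
  their limit share one recursion.\<close>

definition step_cost :: "('t \<Rightarrow> 'a \<Rightarrow> 't list pmf) \<Rightarrow> ('t \<Rightarrow> 'a \<Rightarrow> real)
    \<Rightarrow> (('t, 'a) hist \<Rightarrow> 't list \<Rightarrow> ennreal) \<Rightarrow> ('t, 'a) hist \<Rightarrow> 't list \<Rightarrow> nat \<times> 'a \<Rightarrow> ennreal" where
  "step_cost p c F h \<alpha> ia = ennreal (c (\<alpha> ! fst ia) (snd ia)) +
     (\<integral>\<^sup>+ \<beta>. F (h @ [(\<alpha>, ia)]) (take (fst ia) \<alpha> @ \<beta> @ drop (Suc (fst ia)) \<alpha>)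
        \<partial>measure_pmf (p (\<alpha> ! fst ia) (snd ia)))"

lemma ecost_Suc:
  "\<alpha> \<noteq> [] \<Longrightarrow> ecost p c \<sigma> (Suc n) h \<alpha> = (\<integral>\<^sup>+ ia. step_cost p c (ecost p c \<sigma> n) h \<alpha> ia \<partial>measure_pmf (\<sigma> h \<alpha>))"
  by (auto simp: step_cost_def intro!: nn_integral_cong)

lemma step_cost_mono: "F \<le> G \<Longrightarrow> step_cost p c F h \<alpha> ia \<le> step_cost p c G h \<alpha> ia"
  unfolding step_cost_def by (intro add_left_mono nn_integral_mono) (auto simp: le_fun_def)

lemma incseq_ecost: "incseq (ecost p c \<sigma>)"
proof (rule incseq_SucI)
  fix n show "ecost p c \<sigma> n \<le> ecost p c \<sigma> (Suc n)"
  proof (induction n)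
    case (Suc n)
    have "ecost p c \<sigma> (Suc n) h \<alpha> \<le> ecost p c \<sigma> (Suc (Suc n)) h \<alpha>" for h \<alpha>
    proof (cases "\<alpha> = []")
      case False
      then show ?thesis
        unfolding ecost_Suc[OF False] by (intro nn_integral_mono step_cost_mono Suc)
    qed simp
    then show ?case by (auto simp: le_fun_def simp del: ecost.simps)
  qed (simp add: le_fun_def)
qed

text \<open>\<open>total_cost\<close> generalised to an arbitrary history: the strategy may react to
  the past, so a recursion over steps needs the costs after all histories.\<close>

definition cost_from :: "('t \<Rightarrow> 'a \<Rightarrow> 't list pmf) \<Rightarrow> ('t \<Rightarrow> 'a \<Rightarrow> real) \<Rightarrow> ('t, 'a) strategy
    \<Rightarrow> ('t, 'a) hist \<Rightarrow> 't list \<Rightarrow> ennreal" where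
  "cost_from p c \<sigma> h \<alpha> = (SUP n. ecost p c \<sigma> n h \<alpha>)"

lemma ecost_le_cost_from: "ecost p c \<sigma> n h \<alpha> \<le> cost_from p c \<sigma> h \<alpha>"
  unfolding cost_from_def by (intro SUP_upper) simp

text \<open>Monotone convergence under both integrals. Shifting the horizon from \<open>n\<close> to
  \<open>Suc n\<close> keeps the supremum because costs increase with the horizon.\<close>

lemma cost_from_rec:
  assumes "\<alpha> \<noteq> []"
  shows "cost_from p c \<sigma> h \<alpha> =
    (\<integral>\<^sup>+ ia. step_cost p c (cost_from p c \<sigma>) h \<alpha> ia \<partial>measure_pmf (\<sigma> h \<alpha>))"
proof -
  have inc: "incseq (\<lambda>n. ecost p c \<sigma> n h \<alpha>)" for h \<alpha>
    using incseq_ecost[of p c \<sigma>] by (auto simp: incseq_def le_fun_def)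
  have "step_cost p c (cost_from p c \<sigma>) h \<alpha> ia =
      (SUP n. step_cost p c (ecost p c \<sigma> n) h \<alpha> ia)" for ia
  proof -
    have "incseq (\<lambda>n \<beta>. ecost p c \<sigma> n (h @ [(\<alpha>, ia)]) (take (fst ia) \<alpha> @ \<beta> @ drop (Suc (fst ia)) \<alpha>))"
      using inc by (auto simp: incseq_def le_fun_def)
    then show ?thesis
      unfolding step_cost_def cost_from_def
      by (simp add: nn_integral_monotone_convergence_SUP ennreal_SUP_add_right)
  qed
  moreover have "incseq (\<lambda>n ia. step_cost p c (ecost p c \<sigma> n) h \<alpha> ia)"
    by (intro monoI le_funI step_cost_mono monoD[OF incseq_ecost])
  ultimately have "(\<integral>\<^sup>+ ia. step_cost p c (cost_from p c \<sigma>) h \<alpha> ia \<partial>measure_pmf (\<sigma> h \<alpha>)) =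
      (SUP n. ecost p c \<sigma> (Suc n) h \<alpha>)"
    using assms by (simp add: nn_integral_monotone_convergence_SUP ecost_Suc del: ecost.simps)
  also have "\<dots> = cost_from p c \<sigma> h \<alpha>"
    unfolding cost_from_def using inc[of h \<alpha>]
    by (intro antisym SUP_least) (auto intro: SUP_upper SUP_upper2 dest: incseq_SucD simp del: ecost.simps)
  finally show ?thesis by simp
qed

lemma valid_strategyD:
  "valid_strategy A \<sigma> \<Longrightarrow> \<alpha> \<noteq> [] \<Longrightarrow> ia \<in> set_pmf (\<sigma> h \<alpha>) \<Longrightarrow>
    fst ia < length \<alpha> \<and> snd ia \<in> A (\<alpha> ! fst ia)"
  unfolding valid_strategy_def by fastforce

text \<open>One step removes at most one entity and costs at least \<open>m\<close>, so emptying the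
  list is paid for entity by entity.\<close>

lemma ecost_ge_length:
  fixes m :: real
  assumes \<sigma>: "valid_strategy A \<sigma>" and c: "\<And>q a. a \<in> A q \<Longrightarrow> m \<le> c q a" and "0 \<le> m"
  shows "ennreal (m * min n (length \<alpha>)) \<le> ecost p c \<sigma> n h \<alpha>"
proof (induction n arbitrary: h \<alpha>)
  case (Suc n)
  show ?case
  proof (cases "\<alpha> = []")
    case False
    show ?thesis
      unfolding ecost_Suc[OF False]
    proof (rule nn_integral_pmf_ge)
      fix ia assume "ia \<in> set_pmf (\<sigma> h \<alpha>)"
      then have ia: "fst ia < length \<alpha>" "snd ia \<in> A (\<alpha> ! fst ia)"
        using valid_strategyD[OF \<sigma> False] by auto
      have "m * min (Suc n) (length \<alpha>) \<le> m + m * min n (length \<alpha> - 1)"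
        using mult_left_mono[of "real (min (Suc n) (length \<alpha>))" "1 + real (min n (length \<alpha> - 1))" m] \<open>0 \<le> m\<close>
        by (simp add: algebra_simps)
      then have "ennreal (m * min (Suc n) (length \<alpha>)) \<le> ennreal m + ennreal (m * min n (length \<alpha> - 1))"
        using \<open>0 \<le> m\<close> by (simp add: ennreal_leI flip: ennreal_plus)
      also have "\<dots> \<le> step_cost p c (ecost p c \<sigma> n) h \<alpha> ia"
        unfolding step_cost_def
      proof (intro add_mono nn_integral_pmf_ge)
        fix \<beta>
        have "ennreal (m * min n (length \<alpha> - 1)) \<le>
          ennreal (m * min n (length (take (fst ia) \<alpha> @ \<beta> @ drop (Suc (fst ia)) \<alpha>)))"
          using ia \<open>0 \<le> m\<close> by (intro ennreal_leI mult_left_mono) auto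
        then show "ennreal (m * min n (length \<alpha> - 1)) \<le>
          ecost p c \<sigma> n (h @ [(\<alpha>, ia)]) (take (fst ia) \<alpha> @ \<beta> @ drop (Suc (fst ia)) \<alpha>)"
          using Suc order_trans by blast
      qed (use c ia in \<open>auto intro: ennreal_leI\<close>)
      finally show "ennreal (m * min (Suc n) (length \<alpha>)) \<le> step_cost p c (ecost p c \<sigma> n) h \<alpha> ia" .
    qed
  qed simp
qed simp

section \<open>Subsolutions of the Bellman equation as lower bounds for every strategy\<close>

lemma sum_list_nth_split:
  fixes v :: "'t \<Rightarrow> ennreal"
  assumes "i < length \<alpha>"
  shows "(\<Sum>x\<leftarrow>\<alpha>. v x) = (\<Sum>x\<leftarrow>take i \<alpha>. v x) + v (\<alpha> ! i) + (\<Sum>x\<leftarrow>drop (Suc i) \<alpha>. v x)"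
  by (subst id_take_nth_drop[OF assms]) (simp add: add.assoc)

text \<open>Sums of \<open>v\<close> are additive over the list and only entity \<open>i\<close> is
  replaced, so the Bellman inequality for that one entity suffices.\<close>

lemma subsolution_step:
  fixes v :: "'t \<Rightarrow> ennreal"
  assumes v: "v \<le> bellman A p c v" and "i < length \<alpha>" and "a \<in> A (\<alpha> ! i)"
  shows "(\<Sum>x\<leftarrow>\<alpha>. v x) \<le> ennreal (c (\<alpha> ! i) a) +
    (\<integral>\<^sup>+ \<beta>. (\<Sum>x\<leftarrow>take i \<alpha> @ \<beta> @ drop (Suc i) \<alpha>. v x) \<partial>measure_pmf (p (\<alpha> ! i) a))"
proof -
  have "v (\<alpha> ! i) \<le> qval p c v (\<alpha> ! i) a"
    using v \<open>a \<in> A (\<alpha> ! i)\<close> unfolding bellman_def le_fun_def by (meson INF_lower order_trans)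
  then have "(\<Sum>x\<leftarrow>\<alpha>. v x) \<le> (\<Sum>x\<leftarrow>take i \<alpha>. v x) + qval p c v (\<alpha> ! i) a + (\<Sum>x\<leftarrow>drop (Suc i) \<alpha>. v x)"
    unfolding sum_list_nth_split[OF \<open>i < length \<alpha>\<close>] by (intro add_mono) auto
  also have "\<dots> = ennreal (c (\<alpha> ! i) a) +
    (\<integral>\<^sup>+ \<beta>. (\<Sum>x\<leftarrow>take i \<alpha> @ \<beta> @ drop (Suc i) \<alpha>. v x) \<partial>measure_pmf (p (\<alpha> ! i) a))"
    by (simp add: qval_def nn_integral_add measure_pmf.emeasure_space_1[simplified] ac_simps)
  finally show ?thesis .
qed

text \<open>Every entity still has to be paid for, so the remaining cost dominates a multiple of the number
  of entities, hence a multiple of the potential. Subtracting \<open>K\<close> times the cost already paid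
  from this bound and iterating removes the constant \<open>K\<close> in the limit.\<close>

lemma subsolution_le_cost_from:
  fixes v :: "'t::finite \<Rightarrow> ennreal"
  assumes \<sigma>: "valid_strategy A \<sigma>" and c: "\<And>q a. a \<in> A q \<Longrightarrow> m \<le> c q a" and "0 < m"
    and v: "v \<le> bellman A p c v" and fin: "\<And>q. v q < \<infinity>"
  shows "(\<Sum>x\<leftarrow>\<alpha>. v x) \<le> cost_from p c \<sigma> h \<alpha>"
proof -
  define M where "M = Max (range (\<lambda>q. enn2real (v q)))"
  have vM: "v q \<le> ennreal M" for q
  proof -
    have "enn2real (v q) \<le> M" unfolding M_def by (intro Max_ge) auto
    then show ?thesis using fin[of q] by (metis ennreal_enn2real ennreal_leI infinity_ennreal_def)
  qed
  have "0 \<le> M"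
  proof -
    have "enn2real (v undefined) \<le> M" unfolding M_def by (intro Max_ge) auto
    then show ?thesis using enn2real_nonneg order_trans by blast
  qed
  \<comment> \<open>\<open>M\<close> bounds the potential of one entity from above and
    \<open>m\<close> the cost of one step from below, so \<open>K\<close> converts cost into
    potential.\<close>
  define K where "K = ennreal (M / m)"
  have UM: "(\<Sum>x\<leftarrow>\<alpha>. v x) \<le> ennreal (M * length \<alpha>)" for \<alpha>
  proof (induction \<alpha>)
    case (Cons x \<alpha>)
    then have "(\<Sum>x\<leftarrow>x # \<alpha>. v x) \<le> ennreal M + ennreal (M * length \<alpha>)"
      using vM by (auto intro: add_mono)
    also have "\<dots> = ennreal (M * length (x # \<alpha>))"
      using \<open>0 \<le> M\<close> by (simp add: algebra_simps flip: ennreal_plus)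
    finally show ?case .
  qed simp
  have base: "(\<Sum>x\<leftarrow>\<alpha>. v x) \<le> K * cost_from p c \<sigma> h \<alpha>" for h \<alpha>
  proof -
    have "ennreal (M * length \<alpha>) = K * ennreal (m * length \<alpha>)"
      using \<open>0 < m\<close> \<open>0 \<le> M\<close> by (simp add: K_def flip: ennreal_mult)
    also have "\<dots> \<le> K * cost_from p c \<sigma> h \<alpha>"
      using ecost_ge_length[OF \<sigma>, of m c "length \<alpha>" \<alpha> p h] c \<open>0 < m\<close>
        ecost_le_cost_from[of p c \<sigma> "length \<alpha>" h \<alpha>]
      by (intro mult_left_mono) (auto intro: order_trans)
    finally show ?thesis using UM order_trans by blast
  qed
  \<comment> \<open>This is the bound \<open>ecost + K * (cost_from - ecost)\<close> on the
    potential, written without subtraction since costs may be infinite.\<close>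
  have step: "(\<Sum>x\<leftarrow>\<alpha>. v x) + K * ecost p c \<sigma> n h \<alpha> \<le> ecost p c \<sigma> n h \<alpha> + K * cost_from p c \<sigma> h \<alpha>" for n h \<alpha>
  proof (induction n arbitrary: h \<alpha>)
    case 0
    then show ?case using base by simp
  next
    case (Suc n)
    show ?case
    proof (cases "\<alpha> = []")
      case False
      have pointwise: "(\<Sum>x\<leftarrow>\<alpha>. v x) + K * step_cost p c (ecost p c \<sigma> n) h \<alpha> ia \<le>
          step_cost p c (ecost p c \<sigma> n) h \<alpha> ia + K * step_cost p c (cost_from p c \<sigma>) h \<alpha> ia"
        if "ia \<in> set_pmf (\<sigma> h \<alpha>)" for ia
      proof -
        let ?P = "measure_pmf (p (\<alpha> ! fst ia) (snd ia))"
        let ?c = "ennreal (c (\<alpha> ! fst ia) (snd ia))"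
        let ?h = "h @ [(\<alpha>, ia)]" and ?\<alpha> = "\<lambda>\<beta>. take (fst ia) \<alpha> @ \<beta> @ drop (Suc (fst ia)) \<alpha>"
        have "(\<Sum>x\<leftarrow>\<alpha>. v x) + K * step_cost p c (ecost p c \<sigma> n) h \<alpha> ia \<le>
            (?c + (\<integral>\<^sup>+ \<beta>. (\<Sum>x\<leftarrow>?\<alpha> \<beta>. v x) \<partial>?P)) + K * (?c + (\<integral>\<^sup>+ \<beta>. ecost p c \<sigma> n ?h (?\<alpha> \<beta>) \<partial>?P))"
          unfolding step_cost_def using valid_strategyD[OF \<sigma> False that]
          by (intro add_right_mono subsolution_step[where A=A] v) auto
        also have "\<dots> = ?c + K * ?c + (\<integral>\<^sup>+ \<beta>. (\<Sum>x\<leftarrow>?\<alpha> \<beta>. v x) + K * ecost p c \<sigma> n ?h (?\<alpha> \<beta>) \<partial>?P)"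
          by (simp only: nn_integral_add nn_integral_cmult borel_measurable_count_space measurable_pmf_measure1 distrib_left ac_simps UNIV_I space_borel Pi_I)
        also have "\<dots> \<le> ?c + K * ?c + (\<integral>\<^sup>+ \<beta>. ecost p c \<sigma> n ?h (?\<alpha> \<beta>) + K * cost_from p c \<sigma> ?h (?\<alpha> \<beta>) \<partial>?P)"
          by (intro add_left_mono nn_integral_mono Suc)
        also have "\<dots> = step_cost p c (ecost p c \<sigma> n) h \<alpha> ia + K * step_cost p c (cost_from p c \<sigma>) h \<alpha> ia"
          unfolding step_cost_def
          by (simp only: nn_integral_add nn_integral_cmult borel_measurable_count_space measurable_pmf_measure1 distrib_left ac_simps UNIV_I space_borel Pi_I)
        finally show ?thesis .
      qed
      have "(\<Sum>x\<leftarrow>\<alpha>. v x) + K * ecost p c \<sigma> (Suc n) h \<alpha> =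
          (\<integral>\<^sup>+ ia. (\<Sum>x\<leftarrow>\<alpha>. v x) + K * step_cost p c (ecost p c \<sigma> n) h \<alpha> ia \<partial>measure_pmf (\<sigma> h \<alpha>))"
        unfolding ecost_Suc[OF False]
        by (simp add: nn_integral_add nn_integral_cmult measure_pmf.emeasure_space_1[simplified])
      also have "\<dots> \<le> (\<integral>\<^sup>+ ia. step_cost p c (ecost p c \<sigma> n) h \<alpha> ia +
          K * step_cost p c (cost_from p c \<sigma>) h \<alpha> ia \<partial>measure_pmf (\<sigma> h \<alpha>))"
        by (intro nn_integral_mono_AE AE_pmfI pointwise)
      also have "\<dots> = ecost p c \<sigma> (Suc n) h \<alpha> + K * cost_from p c \<sigma> h \<alpha>"
        unfolding ecost_Suc[OF False] cost_from_rec[OF False]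
        by (simp add: nn_integral_add nn_integral_cmult)
      finally show ?thesis .
    qed simp
  qed
  show ?thesis
  proof (cases "cost_from p c \<sigma> h \<alpha> = \<infinity>")
    case False
    \<comment> \<open>Letting the horizon grow makes the two multiples of \<open>K\<close> equal.
      They are finite in this case and cancel.\<close>
    have "(\<Sum>x\<leftarrow>\<alpha>. v x) + K * cost_from p c \<sigma> h \<alpha> = (SUP n. (\<Sum>x\<leftarrow>\<alpha>. v x) + K * ecost p c \<sigma> n h \<alpha>)"
      unfolding cost_from_def by (simp add: ennreal_SUP_add_right SUP_mult_left_ennreal)
    also have "\<dots> \<le> cost_from p c \<sigma> h \<alpha> + K * cost_from p c \<sigma> h \<alpha>"
      by (intro SUP_least order_trans[OF step] add_right_mono ecost_le_cost_from)
    finally show ?thesis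
      using False by (simp add: K_def ennreal_mult_eq_top_iff add.commute)
  qed simp
qed

section \<open>Greedy strategies and the limit of value iteration\<close>

lemma bellman_attained:
  fixes A :: "'t \<Rightarrow> 'a::finite set"
  assumes "A q \<noteq> {}"
  obtains a where "a \<in> A q" "bellman A p c v q = qval p c v q a"
proof -
  have "bellman A p c v q = Min (qval p c v q ` A q)"
    unfolding bellman_def using assms by (intro cInf_eq_Min) auto
  also have "\<dots> \<in> qval p c v q ` A q"
    using assms by (intro Min_in) auto
  finally show ?thesis using that by blast
qed

lemma qval_finite:
  assumes "finite (set_pmf (p q a))" and "\<And>x. v x < \<infinity>"
  shows "qval p c v q a < \<infinity>"
proof -
  have "(\<Sum>x\<leftarrow>\<beta>. v x) < top" for \<beta>
    using assms(2) by (induction \<beta>) auto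
  then show ?thesis
    using assms(1)
    by (auto simp: qval_def nn_integral_measure_pmf_finite ennreal_mult_less_top)
qed

text \<open>A supersolution is a budget: it covers the cost of rewriting the first entity together
  with the expected potential of the new list. This holds for every horizon, hence in the
  limit.\<close>

lemma cost_from_greedy_le:
  assumes "\<And>q. qval p c w q (g q) \<le> w q"
  shows "cost_from p c (\<lambda>h \<alpha>. return_pmf (0, g (hd \<alpha>))) h \<alpha> \<le> (\<Sum>x\<leftarrow>\<alpha>. w x)"
  unfolding cost_from_def
proof (rule SUP_least)
  fix n
  show "ecost p c (\<lambda>h \<alpha>. return_pmf (0, g (hd \<alpha>))) n h \<alpha> \<le> (\<Sum>x\<leftarrow>\<alpha>. w x)"
  proof (induction n arbitrary: h \<alpha>)
    case (Suc n)
    show ?case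
    proof (cases \<alpha>)
      case (Cons q \<alpha>')
      have "ecost p c (\<lambda>h \<alpha>. return_pmf (0, g (hd \<alpha>))) (Suc n) h \<alpha> \<le>
          ennreal (c q (g q)) + (\<integral>\<^sup>+\<beta>. (\<Sum>x\<leftarrow>\<beta> @ \<alpha>'. w x) \<partial>measure_pmf (p q (g q)))"
        using Suc by (auto simp: Cons simp del: map_append intro!: add_left_mono nn_integral_mono)
      also have "\<dots> = qval p c w q (g q) + (\<Sum>x\<leftarrow>\<alpha>'. w x)"
        by (simp add: qval_def nn_integral_add measure_pmf.emeasure_space_1[simplified] ac_simps)
      also have "\<dots> \<le> (\<Sum>x\<leftarrow>\<alpha>. w x)"
        using assms[of q] by (simp add: Cons add_right_mono)
      finally show ?thesis .
    qed simp
  qed simp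
qed

text \<open>Value iteration \<open>u\<close> from zero increases to \<open>w\<close>. Each
  \<open>u k\<close> is a subsolution and bounds all strategies from below, while a greedy choice
  for \<open>w\<close> costs at most \<open>w\<close>. Only the finite \<open>u k\<close> enter the
  lower bound, so \<open>w\<close> itself may be infinite.\<close>

theorem opt_cost_eq_bellman:
  fixes A :: "'t::finite \<Rightarrow> 'a::finite set"
  assumes B: "bmdp A p c"
  shows "opt_cost A p c = bellman A p c (opt_cost A p c)"
proof -
  have ne: "A q \<noteq> {}" and fin: "a \<in> A q \<Longrightarrow> finite (set_pmf (p q a))" and cpos: "a \<in> A q \<Longrightarrow> 0 < c q a" for q a
    using B by (auto simp: bmdp_def)
  define m where "m = Min ((\<lambda>(q, a). c q a) ` (SIGMA q:UNIV. A q))"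
  have "0 < m"
    unfolding m_def using ne cpos by (subst Min_gr_iff) (auto simp: Sigma_empty_iff)
  have m: "m \<le> c q a" if "a \<in> A q" for q a
    unfolding m_def using that by (intro Min_le) (auto simp: image_iff intro!: bexI[of _ "(q, a)"])
  define u where "u k = (bellman A p c ^^ k) (\<lambda>_. 0)" for k
  have u_Suc: "u (Suc k) = bellman A p c (u k)" for k by (simp add: u_def)
  have u_le: "u k \<le> u (Suc k)" for k
  proof (induction k)
    case (Suc k) then show ?case unfolding u_Suc[of k] u_Suc[of "Suc k"] by (intro bellman_mono) (simp add: u_Suc)
  qed (simp add: u_def le_fun_def)
  then have inc: "incseq u" by (rule incseq_SucI)
  have u_fin: "u k q < \<infinity>" for k q
  proof (induction k arbitrary: q)
    case (Suc k)
    obtain a where "a \<in> A q" "bellman A p c (u k) q = qval p c (u k) q a"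
      using bellman_attained[of A q p c "u k"] ne by blast
    then show ?case using qval_finite[of p q a "u k" c] fin Suc by (simp add: u_Suc)
  qed (simp add: u_def)
  define w where "w q = (SUP k. u k q)" for q
  have u_w: "u k \<le> w" for k by (auto simp: le_fun_def w_def intro: SUP_upper)
  \<comment> \<open>The minimising action may change with \<open>k\<close>. Among finitely many
    actions one is minimal for infinitely many \<open>k\<close>, and by monotonicity it works in the
    limit.\<close>
  have "\<exists>a\<in>A q. qval p c w q a \<le> w q" for q
  proof -
    have "\<exists>a\<in>A q. u (Suc k) q = qval p c (u k) q a" for k
      using bellman_attained[where A=A, OF ne] by (metis u_Suc)
    then have "\<exists>a\<in>A q. infinite {k \<in> UNIV. u (Suc k) q = qval p c (u k) q a}"
      by (intro pigeonhole_infinite_rel) auto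
    then obtain a where a: "a \<in> A q" "infinite {k. u (Suc k) q = qval p c (u k) q a}" by auto
    have "qval p c (u k) q a \<le> w q" for k
    proof -
      obtain k' where "k \<le> k'" "u (Suc k') q = qval p c (u k') q a"
        using a(2) unfolding infinite_nat_iff_unbounded_le by auto
      then show ?thesis
        using qval_mono[of "u k" "u k'" p c q a] inc u_w[of "Suc k'"]
        by (metis incseqD le_funD order_trans)
    qed
    then have "qval p c w q a \<le> w q"
      unfolding w_def[abs_def] SUP_qval[OF inc] by (intro SUP_least)
    then show ?thesis using a by blast
  qed
  then obtain g where g: "\<And>q. g q \<in> A q" "\<And>q. qval p c w q (g q) \<le> w q" by metis
  have total: "total_cost p c \<sigma> \<alpha> = cost_from p c \<sigma> [] \<alpha>" for \<sigma> \<alpha>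
    by (simp add: total_cost_def cost_from_def)
  have "opt_cost A p c q \<le> w q" for q
  proof -
    have "valid_strategy A (\<lambda>h \<alpha>. return_pmf (0, g (hd \<alpha>)))"
      using g(1) by (auto simp: valid_strategy_def hd_conv_nth)
    then have "opt_cost A p c q \<le> cost_from p c (\<lambda>h \<alpha>. return_pmf (0, g (hd \<alpha>))) [] [q]"
      unfolding opt_cost_def total by (intro INF_lower) auto
    also have "\<dots> \<le> w q"
      using cost_from_greedy_le[of p c w g "[]" "[q]"] g(2) by simp
    finally show ?thesis .
  qed
  moreover have "w q \<le> opt_cost A p c q" for q
    unfolding opt_cost_def w_def total
  proof (intro SUP_least INF_greatest)
    fix k \<sigma> assume "\<sigma> \<in> {\<sigma>. valid_strategy A \<sigma>}"
    then show "u k q \<le> cost_from p c \<sigma> [] [q]"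
      using subsolution_le_cost_from[of A \<sigma> m c "u k" p "[q]" "[]"] m \<open>0 < m\<close> u_le[of k] u_fin
      by (simp add: u_Suc)
  qed
  ultimately have opt: "opt_cost A p c = w" by (intro ext antisym)
  have "bellman A p c w q \<le> w q" for q
    using g by (auto simp: bellman_def intro: INF_lower2)
  moreover have "w q \<le> bellman A p c w q" for q
    unfolding w_def[of q] using bellman_mono[OF u_w, of A p c] u_le
    by (intro SUP_least) (metis le_funD order_trans u_Suc)
  ultimately show ?thesis unfolding opt by (intro ext antisym)
qed

subsection \<open>Lyapunov functions for chains driven by i.i.d. samples\<close>

primrec run :: "(nat \<Rightarrow> 'x \<Rightarrow> 's \<Rightarrow> 'x) \<Rightarrow> 'x \<Rightarrow> 's stream \<Rightarrow> nat \<Rightarrow> 'x" where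
  "run f x \<omega> 0 = x"
| "run f x \<omega> (Suc i) = f i (run f x \<omega> i) (\<omega> !! i)"

text \<open>First-step decomposition: after one sample the chain restarts with its update functions
  shifted in time. Hence the inductions below vary \<open>f\<close> and the start state
  together.\<close>

lemma run_Stream: "run f x (s ## \<omega>) (Suc i) = run (\<lambda>i. f (Suc i)) (f 0 x s) \<omega> i"
  by (induction i) auto

lemma run_factors_through_stake: "\<exists>F. \<forall>\<omega>. run f x \<omega> i = F (stake i \<omega>)"
proof (induction i)
  case (Suc i)
  then obtain F where "\<And>\<omega>. run f x \<omega> i = F (stake i \<omega>)" by blast
  then have "\<forall>\<omega>. run f x \<omega> (Suc i) = (\<lambda>l. f i (F (butlast l)) (last l)) (stake (Suc i) \<omega>)"
    by (simp add: stake_Suc del: stake.simps)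
  then show ?case by (intro exI)
qed auto

lemma sets_stream_space_pmf [measurable_cong]:
  "sets (stream_space (measure_pmf K)) = sets (stream_space (count_space UNIV))"
  by (rule sets_stream_space_cong) simp

lemma space_stream_space_pmf [simp]: "space (stream_space (measure_pmf K)) = UNIV"
  by (simp add: space_stream_space)

text \<open>The state depends on finitely many samples from a countable set, so it is measurable
  even into the discrete sigma-algebra of an uncountable state space.\<close>

lemma measurable_run [measurable]:
  fixes K :: "'s::countable pmf"
  shows "(\<lambda>\<omega>. run f x \<omega> i) \<in> stream_space (measure_pmf K) \<rightarrow>\<^sub>M count_space UNIV"
proof -
  obtain F where F: "\<And>\<omega>. run f x \<omega> i = F (stake i \<omega>)"
    using run_factors_through_stake[of f x i] by blast
  show ?thesis
    unfolding F by measurable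
qed

lemma measurable_run_compose [measurable (raw)]:
  fixes K :: "'s::countable pmf"
  assumes "g \<in> UNIV \<rightarrow> space N"
  shows "(\<lambda>\<omega>. g (run f x \<omega> i)) \<in> stream_space (measure_pmf K) \<rightarrow>\<^sub>M N"
  by (rule measurable_compose[OF measurable_run]) (use assms in simp)

text \<open>Sample \<open>n\<close> is independent of the state reached before it, so it can be
  averaged out first. The proof peels off the first sample of the stream and restarts the
  chain.\<close>

lemma nn_integral_run_Suc:
  fixes K :: "'s::countable pmf" and g :: "'x \<Rightarrow> ennreal"
  shows "(\<integral>\<^sup>+\<omega>. g (run f x \<omega> (Suc n)) \<partial>stream_space (measure_pmf K)) =
         (\<integral>\<^sup>+\<omega>. (\<integral>\<^sup>+s. g (f n (run f x \<omega> n) s) \<partial>measure_pmf K) \<partial>stream_space (measure_pmf K))"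
proof -
  interpret S: prob_space "stream_space (measure_pmf K)"
    by (rule prob_space.prob_space_stream_space[OF prob_space_measure_pmf])
  show ?thesis
  proof (induction n arbitrary: f x)
    case 0
    show ?case
      by (subst prob_space.nn_integral_stream_space[OF prob_space_measure_pmf])
        (auto intro!: measurable_run_compose simp: run_Stream S.emeasure_space_1 simp del: run.simps(2) simp flip: space_stream_space_pmf)
  next
    case (Suc n)
    show ?case
      by (subst (1 2) prob_space.nn_integral_stream_space[OF prob_space_measure_pmf])
        (auto intro!: measurable_run_compose simp: run_Stream Suc simp del: run.simps(2))
  qed
qed

lemma AE_run_invariant:
  fixes K :: "'s::countable pmf"
  assumes inv: "\<And>i x s. x \<in> I \<Longrightarrow> s \<in> set_pmf K \<Longrightarrow> f i x s \<in> I" and "x \<in> I"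
  shows "AE \<omega> in stream_space (measure_pmf K). \<forall>i. run f x \<omega> i \<in> I"
proof -
  have "AE \<omega> in stream_space (measure_pmf K). stream_all (\<lambda>s. s \<in> set_pmf K) \<omega>"
    by (intro prob_space.AE_stream_all[OF prob_space_measure_pmf]) (auto simp: AE_measure_pmf)
  then show ?thesis
  proof eventually_elim
    case (elim \<omega>)
    show ?case
    proof
      fix i show "run f x \<omega> i \<in> I"
        using elim \<open>x \<in> I\<close> by (induction i) (auto simp: stream_all_def intro: inv)
    qed
  qed
qed

section \<open>Ville's maximal inequality\<close>

lemma measurable_run_ex:
  fixes K :: "'s::countable pmf"
  shows "{\<omega>. \<exists>i\<in>J. B i (run f x \<omega> i)} \<in> sets (stream_space (measure_pmf K))"
proof -
  have "Measurable.pred (stream_space (measure_pmf K)) (\<lambda>\<omega>. \<exists>i\<in>J. B i (run f x \<omega> i))"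
    by (intro pred_intros_countable_bounded measurable_run_compose) auto
  then show ?thesis
    by (simp add: pred_def)
qed

lemma emeasure_run_Stream:
  fixes K :: "'s::countable pmf"
  shows "emeasure (stream_space (measure_pmf K)) {\<omega>. \<exists>i\<in>Suc ` J. B i (run f x \<omega> i)} =
    (\<integral>\<^sup>+s. emeasure (stream_space (measure_pmf K))
       {\<omega>. \<exists>i\<in>J. B (Suc i) (run (\<lambda>i. f (Suc i)) (f 0 x s) \<omega> i)} \<partial>measure_pmf K)"
  by (subst prob_space.emeasure_stream_space[OF prob_space_measure_pmf measurable_run_ex])
    (simp add: run_Stream del: run.simps(2))

text \<open>\<open>\<Phi>\<close> is a nonnegative supermartingale along the chain and at least 1 on
  \<open>B\<close>. Either \<open>B\<close> holds at the start, where 1 already bounds the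
  probability, or the first step is averaged and the induction hypothesis applies to the shifted
  chain.\<close>

lemma Ville_inequality_finite_horizon:
  fixes K :: "'s::countable pmf" and \<Phi> :: "nat \<Rightarrow> 'x \<Rightarrow> ennreal"
  assumes "\<And>i x s. x \<in> I \<Longrightarrow> s \<in> set_pmf K \<Longrightarrow> f i x s \<in> I"
    and "\<And>i x. x \<in> I \<Longrightarrow> (\<integral>\<^sup>+s. \<Phi> (Suc i) (f i x s) \<partial>measure_pmf K) \<le> \<Phi> i x"
    and "\<And>i x. x \<in> I \<Longrightarrow> B i x \<Longrightarrow> 1 \<le> \<Phi> i x"
    and "x \<in> I"
  shows "emeasure (stream_space (measure_pmf K)) {\<omega>. \<exists>i\<in>{..<N}. B i (run f x \<omega> i)} \<le> \<Phi> 0 x"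
  using assms
proof (induction N arbitrary: f \<Phi> B x)
  case (Suc N)
  interpret S: prob_space "stream_space (measure_pmf K)"
    by (rule prob_space.prob_space_stream_space[OF prob_space_measure_pmf])
  show ?case
  proof (cases "B 0 x")
    case True
    then show ?thesis
      using Suc.prems(3)[of x 0] Suc.prems(4) S.emeasure_le_1 order_trans by blast
  next
    case False
    then have "{\<omega>. \<exists>i\<in>{..<Suc N}. B i (run f x \<omega> i)} = {\<omega>. \<exists>i\<in>Suc ` {..<N}. B i (run f x \<omega> i)}"
      unfolding lessThan_Suc_eq_insert_0 by (simp del: run.simps(2))
    then have "emeasure (stream_space (measure_pmf K)) {\<omega>. \<exists>i\<in>{..<Suc N}. B i (run f x \<omega> i)} =
      (\<integral>\<^sup>+s. emeasure (stream_space (measure_pmf K))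
         {\<omega>. \<exists>i\<in>{..<N}. B (Suc i) (run (\<lambda>i. f (Suc i)) (f 0 x s) \<omega> i)} \<partial>measure_pmf K)"
      by (simp only: emeasure_run_Stream)
    also have "\<dots> \<le> (\<integral>\<^sup>+s. \<Phi> (Suc 0) (f 0 x s) \<partial>measure_pmf K)"
      by (intro nn_integral_mono_AE AE_pmfI Suc.IH[where \<Phi>="\<lambda>i. \<Phi> (Suc i)"])
         (use Suc.prems in auto)
    also have "\<dots> \<le> \<Phi> 0 x"
      using Suc.prems by auto
    finally show ?thesis .
  qed
qed auto

text \<open>The supermartingale property may begin only at time \<open>n\<close>. Peeling off
  \<open>n\<close> samples reduces to the previous case, with the initial value replaced by the
  expectation of \<open>\<Phi> n\<close>.\<close>

lemma Ville_inequality_from_finite_horizon: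
  fixes K :: "'s::countable pmf" and \<Phi> :: "nat \<Rightarrow> 'x \<Rightarrow> ennreal"
  assumes "\<And>i x s. x \<in> I \<Longrightarrow> s \<in> set_pmf K \<Longrightarrow> f i x s \<in> I"
    and "\<And>i x. n \<le> i \<Longrightarrow> x \<in> I \<Longrightarrow> (\<integral>\<^sup>+s. \<Phi> (Suc i) (f i x s) \<partial>measure_pmf K) \<le> \<Phi> i x"
    and "\<And>i x. n \<le> i \<Longrightarrow> x \<in> I \<Longrightarrow> B i x \<Longrightarrow> 1 \<le> \<Phi> i x"
    and "x \<in> I"
  shows "emeasure (stream_space (measure_pmf K)) {\<omega>. \<exists>i\<in>{n..<n+N}. B i (run f x \<omega> i)}
    \<le> (\<integral>\<^sup>+\<omega>. \<Phi> n (run f x \<omega> n) \<partial>stream_space (measure_pmf K))"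
  using assms
proof (induction n arbitrary: f \<Phi> B x)
  case 0
  interpret S: prob_space "stream_space (measure_pmf K)"
    by (rule prob_space.prob_space_stream_space[OF prob_space_measure_pmf])
  show ?case
    using Ville_inequality_finite_horizon[of I K f \<Phi> B x N] 0 S.emeasure_space_1
    by (simp add: atLeast0LessThan)
next
  case (Suc n)
  have "emeasure (stream_space (measure_pmf K)) {\<omega>. \<exists>i\<in>{Suc n..<Suc n+N}. B i (run f x \<omega> i)} =
      (\<integral>\<^sup>+s. emeasure (stream_space (measure_pmf K))
         {\<omega>. \<exists>i\<in>{n..<n+N}. B (Suc i) (run (\<lambda>i. f (Suc i)) (f 0 x s) \<omega> i)} \<partial>measure_pmf K)"
    by (subst emeasure_run_Stream[symmetric]) (simp del: run.simps(2))
  also have "\<dots> \<le> (\<integral>\<^sup>+s. (\<integral>\<^sup>+\<omega>. \<Phi> (Suc n) (run (\<lambda>i. f (Suc i)) (f 0 x s) \<omega> n)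
      \<partial>stream_space (measure_pmf K)) \<partial>measure_pmf K)"
    by (intro nn_integral_mono_AE AE_pmfI Suc.IH[where \<Phi>="\<lambda>i. \<Phi> (Suc i)"])
      (use Suc.prems in auto)
  also have "\<dots> = (\<integral>\<^sup>+\<omega>. \<Phi> (Suc n) (run f x \<omega> (Suc n)) \<partial>stream_space (measure_pmf K))"
    by (subst prob_space.nn_integral_stream_space[OF prob_space_measure_pmf])
        (auto intro!: measurable_run_compose simp: run_Stream simp del: run.simps(2))
  finally show ?case .
qed

lemma Ville_inequality_from:
  fixes K :: "'s::countable pmf" and \<Phi> :: "nat \<Rightarrow> 'x \<Rightarrow> ennreal"
  assumes "\<And>i x s. x \<in> I \<Longrightarrow> s \<in> set_pmf K \<Longrightarrow> f i x s \<in> I"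
    and "\<And>i x. n \<le> i \<Longrightarrow> x \<in> I \<Longrightarrow> (\<integral>\<^sup>+s. \<Phi> (Suc i) (f i x s) \<partial>measure_pmf K) \<le> \<Phi> i x"
    and "\<And>i x. n \<le> i \<Longrightarrow> x \<in> I \<Longrightarrow> B i x \<Longrightarrow> 1 \<le> \<Phi> i x"
    and "x \<in> I"
  shows "emeasure (stream_space (measure_pmf K)) {\<omega>. \<exists>i\<in>{n..}. B i (run f x \<omega> i)}
    \<le> (\<integral>\<^sup>+\<omega>. \<Phi> n (run f x \<omega> n) \<partial>stream_space (measure_pmf K))"
proof -
  let ?E = "\<lambda>N. {\<omega>. \<exists>i\<in>{n..<n+N}. B i (run f x \<omega> i)}"
  have "i \<in> {n..} \<longleftrightarrow> (\<exists>N. i \<in> {n..<n+N})" for i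
    by (auto intro!: exI[of _ "Suc (i - n)"])
  then have "{\<omega>. \<exists>i\<in>{n..}. B i (run f x \<omega> i)} = (\<Union>N. ?E N)"
    by blast
  moreover have "incseq ?E"
    by (force simp: incseq_def)
  ultimately have "emeasure (stream_space (measure_pmf K)) {\<omega>. \<exists>i\<in>{n..}. B i (run f x \<omega> i)} =
      (SUP N. emeasure (stream_space (measure_pmf K)) (?E N))"
    by (subst SUP_emeasure_incseq) (auto intro: measurable_run_ex)
  also have "\<dots> \<le> (\<integral>\<^sup>+\<omega>. \<Phi> n (run f x \<omega> n) \<partial>stream_space (measure_pmf K))"
    by (intro SUP_least Ville_inequality_from_finite_horizon[where I=I]) (use assms in auto)
  finally show ?thesis .
qed

section \<open>From a drift condition to almost sure convergence\<close>

text \<open>Deterministic Robbins-Siegmund argument: \<open>a\<close> minus the accumulated errors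
  decreases and is bounded below, so \<open>a\<close> converges. The same telescoping makes
  \<open>b n * a n\<close> summable, which a positive limit would contradict as \<open>b\<close> is
  not summable.\<close>

lemma perturbed_decrease_tendsto_0:
  fixes a b s :: "nat \<Rightarrow> real"
  assumes nonneg: "\<And>n. 0 \<le> a n" "\<And>n. 0 \<le> b n" "\<And>n. 0 \<le> s n"
    and step: "\<And>n. a (Suc n) \<le> (1 - b n) * a n + s n"
    and "\<not> summable b" and s: "summable s"
  shows "a \<longlonglongrightarrow> 0"
proof -
  define S where "S n = a n - (\<Sum>i<n. s i)" for n
  have le: "S (Suc n) \<le> S n - b n * a n" for n
    using step[of n] by (simp add: S_def algebra_simps)
  have "decseq S"
    unfolding decseq_Suc_iff using le nonneg by (meson diff_le_eq le_add_same_cancel1 mult_nonneg_nonneg order_trans)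
  moreover have bd: "- (\<Sum>i. s i) \<le> S n" for n
    using sum_le_suminf[OF s, of "{..<n}"] nonneg(1)[of n] nonneg(3) by (simp add: S_def)
  ultimately obtain L0 where "S \<longlonglongrightarrow> L0"
    using decseq_convergent[of S "- (\<Sum>i. s i)"] by blast
  then have "(\<lambda>n. S n + (\<Sum>i<n. s i)) \<longlonglongrightarrow> L0 + (\<Sum>i. s i)"
    using s by (intro tendsto_add summable_LIMSEQ)
  moreover define L where "L = L0 + (\<Sum>i. s i)"
  ultimately have L: "a \<longlonglongrightarrow> L" by (simp add: S_def)
  have "L \<ge> 0" using L nonneg by (meson LIMSEQ_le_const)
  have "summable (\<lambda>n. b n * a n)"
  proof (rule summableI_nonneg_bounded)
    fix n
    have "(\<Sum>i<n. b i * a i) \<le> S 0 - S n"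
    proof (induction n)
      case (Suc n) then show ?case using le[of n] by simp
    qed simp
    then show "(\<Sum>i<n. b i * a i) \<le> S 0 + (\<Sum>i. s i)" using bd[of n] by linarith
  qed (use nonneg in auto)
  have "L = 0"
  proof (rule ccontr)
    assume "L \<noteq> 0"
    then have "L > 0" using \<open>L \<ge> 0\<close> by simp
    then have "eventually (\<lambda>n. a n > L/2) sequentially"
      using L by (intro order_tendstoD) auto
    then have "eventually (\<lambda>n. norm (b n) \<le> 2/L * (b n * a n)) sequentially"
    proof eventually_elim
      case (elim n)
      then have "b n * (L/2) \<le> b n * a n" using nonneg by (intro mult_left_mono) auto
      then show ?case using \<open>L > 0\<close> nonneg by (simp add: field_simps)
    qed
    then have "summable b"
      by (rule summable_comparison_test_ev) (intro summable_mult \<open>summable (\<lambda>n. b n * a n)\<close>)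
    then show False using \<open>\<not> summable b\<close> by simp
  qed
  then show ?thesis using L by simp
qed

text \<open>The drift first forces the expectation of \<open>V\<close> to 0. Ville's inequality then
  bounds the probability that \<open>V\<close> ever reaches a level \<open>t\<close> after time
  \<open>n\<close> by a quantity that vanishes as \<open>n\<close> grows.\<close>

lemma run_Lyapunov_tendsto_0:
  fixes K :: "'s::countable pmf" and V :: "'x \<Rightarrow> real"
  assumes inv: "\<And>i x s. x \<in> I \<Longrightarrow> s \<in> set_pmf K \<Longrightarrow> f i x s \<in> I"
    and "x \<in> I"
    and V: "\<And>x. 0 \<le> V x"
    and drift: "\<And>i x. x \<in> I \<Longrightarrow> (\<integral>\<^sup>+s. ennreal (V (f i x s)) \<partial>measure_pmf K)
      \<le> ennreal ((1 - \<delta> * lr i + C * (lr i)\<^sup>2) * V x + C * (lr i)\<^sup>2)"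
    and lr: "\<And>i. 0 \<le> lr i" "\<And>i. lr i \<le> 1" "\<not> summable lr" "summable (\<lambda>i. (lr i)\<^sup>2)"
    and \<delta>: "0 < \<delta>" "\<delta> \<le> 1" and "0 \<le> C"
  shows "AE \<omega> in stream_space (measure_pmf K). (\<lambda>i. V (run f x \<omega> i)) \<longlonglongrightarrow> 0"
proof -
  let ?S = "stream_space (measure_pmf K)"
  interpret S: prob_space ?S
    by (rule prob_space.prob_space_stream_space[OF prob_space_measure_pmf])
  define r where "r i = 1 - \<delta> * lr i + C * (lr i)\<^sup>2" for i
  define s where "s i = C * (lr i)\<^sup>2" for i
  have r0: "0 \<le> r i" for i
    using mult_mono[OF \<delta>(2) lr(2)[of i]] lr(1)[of i] \<delta> \<open>0 \<le> C\<close>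
    by (simp add: r_def)
  have s0: "0 \<le> s i" for i using \<open>0 \<le> C\<close> by (simp add: s_def)
  have s: "summable s" unfolding s_def using lr by (intro summable_mult)
  have "(\<lambda>i. sqrt ((lr i)\<^sup>2)) \<longlonglongrightarrow> sqrt 0"
    by (intro tendsto_real_sqrt summable_LIMSEQ_zero lr)
  then have "lr \<longlonglongrightarrow> 0" using lr(1) by simp
  then have "(\<lambda>i. C * lr i) \<longlonglongrightarrow> C * 0" by (intro tendsto_intros)
  then have "eventually (\<lambda>i. C * lr i < \<delta>/2) sequentially"
    using \<delta> by (intro order_tendstoD) auto
  \<comment> \<open>Beyond \<open>N0\<close> the quadratic term is at most half of the linear one,
    which leaves the rate \<open>\<delta>/2\<close>.\<close>
  then obtain N0 where "\<And>i. N0 \<le> i \<Longrightarrow> C * lr i < \<delta>/2"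
    by (auto simp: eventually_sequentially)
  then have "\<And>i. N0 \<le> i \<Longrightarrow> lr i * (C * lr i) \<le> lr i * (\<delta>/2)"
    using lr(1) by (intro mult_left_mono) (auto intro: less_imp_le)
  then have r_le: "r i \<le> 1 - \<delta>/2 * lr i" if "N0 \<le> i" for i
    using that by (force simp: r_def power2_eq_square algebra_simps)

  define E where "E n = (\<integral>\<^sup>+\<omega>. ennreal (V (run f x \<omega> n)) \<partial>?S)" for n
  have AE_I: "AE \<omega> in ?S. run f x \<omega> n \<in> I" for n
    using AE_run_invariant[of I K f x] inv \<open>x \<in> I\<close> by auto
  have E_Suc: "E (Suc n) \<le> ennreal (r n) * E n + ennreal (s n)" for n
  proof -
    have "E (Suc n) \<le> (\<integral>\<^sup>+\<omega>. ennreal (r n) * ennreal (V (run f x \<omega> n)) + ennreal (s n) \<partial>?S)"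
      unfolding E_def nn_integral_run_Suc[where g="\<lambda>y. ennreal (V y)"]
      using AE_I[of n]
      by (intro nn_integral_mono_AE, eventually_elim)
        (use drift V r0 s0 in \<open>simp add: r_def s_def flip: ennreal_mult ennreal_plus\<close>)
    also have "\<dots> = ennreal (r n) * E n + ennreal (s n)"
      unfolding E_def
      by (subst nn_integral_add)
        (auto intro!: measurable_run_compose simp: nn_integral_cmult S.emeasure_space_1 simp flip: space_stream_space_pmf)
    finally show ?thesis .
  qed
  have E_fin: "E n < \<infinity>" for n
  proof (induction n)
    case 0
    then show ?case by (simp add: E_def S.emeasure_space_1 flip: space_stream_space_pmf)
  next
    case (Suc n)
    then show ?case using E_Suc[of n]
      by (metis ennreal_add_eq_top ennreal_less_top ennreal_mult_less_top infinity_ennreal_def less_top not_le)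
  qed
  define a where "a n = enn2real (E n)" for n
  have E_a: "E n = ennreal (a n)" and a0: "0 \<le> a n" for n
    using E_fin[of n] by (auto simp: a_def)
  have a_Suc: "a (Suc n) \<le> r n * a n + s n" for n
    using E_Suc[of n] r0 s0 a0
    by (simp add: E_a flip: ennreal_mult ennreal_plus)
  \<comment> \<open>The clean decrease is available only from \<open>N0\<close> on. Dropping
    finitely many terms affects neither the divergence of the rates nor the limit.\<close>
  have "(\<lambda>n. a (n + N0)) \<longlonglongrightarrow> 0"
  proof (rule perturbed_decrease_tendsto_0)
    fix n
    have "r (n + N0) * a (n + N0) \<le> (1 - \<delta>/2 * lr (n + N0)) * a (n + N0)"
      by (intro mult_right_mono r_le a0) simp
    then show "a (Suc n + N0) \<le> (1 - \<delta>/2 * lr (n + N0)) * a (n + N0) + s (n + N0)"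
      using a_Suc[of "n + N0"] by simp
    have "\<not> summable (\<lambda>n. lr (n + N0))" using lr(3) by simp
    then show "\<not> summable (\<lambda>n. \<delta>/2 * lr (n + N0))"
      using \<delta> summable_mult_D[of "\<delta>/2"] by force
    show "summable (\<lambda>n. s (n + N0))" using s by simp
  qed (use \<delta> lr s0 a0 in auto)
  then have a: "a \<longlonglongrightarrow> 0" by (rule LIMSEQ_offset)

  \<comment> \<open>\<open>tail n\<close> is what the additive errors can still contribute. Adding
    it to \<open>V\<close> compensates them and gives a supermartingale from \<open>N0\<close>
    on.\<close>
  define tail where "tail n = (\<Sum>i. s (i + n))" for n
  have tail: "tail \<longlonglongrightarrow> 0"
    unfolding tail_def by (rule suminf_exist_split2[OF s])
  have tail_Suc: "tail n = s n + tail (Suc n)" for n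
    using suminf_split_head[of "\<lambda>i. s (i + n)"] s by (simp add: tail_def)
  have tail0: "0 \<le> tail n" for n
    unfolding tail_def using s s0 by (intro suminf_nonneg) auto

  have AE_lt: "AE \<omega> in ?S. \<exists>n. \<forall>i\<ge>n. V (run f x \<omega> i) < t" if "0 < t" for t
  proof -
    let ?B = "\<lambda>n. {\<omega>. \<exists>i\<in>{n..}. t \<le> V (run f x \<omega> i)}"
    \<comment> \<open>Dividing by \<open>t\<close> normalises the level to 1, as Ville's inequality
      requires.\<close>
    define \<Phi> where "\<Phi> n y = ennreal ((V y + tail n) / t)" for n y
    have bound: "emeasure ?S (\<Inter>n. ?B n) \<le> ennreal ((a n + tail n) / t)" if "N0 \<le> n" for n
    proof -
      have "emeasure ?S (\<Inter>n. ?B n) \<le> emeasure ?S (?B n)"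
        by (intro emeasure_mono measurable_run_ex) auto
      also have "\<dots> \<le> (\<integral>\<^sup>+\<omega>. \<Phi> n (run f x \<omega> n) \<partial>?S)"
      proof (rule Ville_inequality_from[where I=I])
        fix i y assume "n \<le> i" "y \<in> I"
        have "(\<integral>\<^sup>+s. \<Phi> (Suc i) (f i y s) \<partial>measure_pmf K) =
            (\<integral>\<^sup>+s. ennreal (1/t) * (ennreal (V (f i y s)) + ennreal (tail (Suc i))) \<partial>measure_pmf K)"
          using V tail0 \<open>0 < t\<close> by (simp add: \<Phi>_def flip: ennreal_mult ennreal_plus)
        also have "\<dots> = ennreal (1/t) * ((\<integral>\<^sup>+s. ennreal (V (f i y s)) \<partial>measure_pmf K) + ennreal (tail (Suc i)))"
          by (simp add: nn_integral_cmult nn_integral_add measure_pmf.emeasure_space_1[simplified])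
        also have "\<dots> \<le> ennreal (1/t) * (ennreal (V y + s i) + ennreal (tail (Suc i)))"
        proof (intro mult_left_mono add_right_mono)
          have "r i \<le> 1"
            using r_le[of i] \<open>N0 \<le> n\<close> \<open>n \<le> i\<close> \<delta> lr(1)[of i] by (smt (verit) mult_nonneg_nonneg half_gt_zero order_trans)
          then have "r i * V y + s i \<le> V y + s i"
            using V[of y] by (simp add: mult_left_le_one_le r0)
          then show "(\<integral>\<^sup>+s. ennreal (V (f i y s)) \<partial>measure_pmf K) \<le> ennreal (V y + s i)"
            using drift[OF \<open>y \<in> I\<close>, of i] unfolding r_def s_def
            by (meson ennreal_leI order_trans)
        qed auto
        also have "\<dots> = \<Phi> i y"
          using V tail0 s0 \<open>0 < t\<close>
          by (simp add: \<Phi>_def tail_Suc[of i] add_divide_distrib add.assoc flip: ennreal_mult ennreal_plus)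
        finally show "(\<integral>\<^sup>+s. \<Phi> (Suc i) (f i y s) \<partial>measure_pmf K) \<le> \<Phi> i y" .
      next
        fix i y assume "t \<le> V y"
        then show "1 \<le> \<Phi> i y"
          using tail0[of i] \<open>0 < t\<close> by (simp add: \<Phi>_def)
      qed (use inv \<open>x \<in> I\<close> in auto)
      also have "\<dots> = (\<integral>\<^sup>+\<omega>. ennreal (1/t) * (ennreal (V (run f x \<omega> n)) + ennreal (tail n)) \<partial>?S)"
        using V tail0 \<open>0 < t\<close> by (simp add: \<Phi>_def flip: ennreal_mult ennreal_plus)
      also have "\<dots> = ennreal (1/t) * (E n + ennreal (tail n))"
        unfolding E_def
        by (subst nn_integral_cmult, auto intro!: measurable_run_compose,
            subst nn_integral_add, auto intro!: measurable_run_compose simp: S.emeasure_space_1 simp flip: space_stream_space_pmf)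
      also have "\<dots> = ennreal ((a n + tail n) / t)"
        using a0 tail0 \<open>0 < t\<close> by (simp add: E_a flip: ennreal_mult ennreal_plus)
      finally show ?thesis .
    qed
    have "(\<lambda>n. ennreal ((a n + tail n) / t)) \<longlonglongrightarrow> ennreal ((0 + 0) / t)"
      using \<open>0 < t\<close> by (intro tendsto_intros a tail) auto
    then have "emeasure ?S (\<Inter>n. ?B n) \<le> ennreal ((0 + 0) / t)"
      by (rule LIMSEQ_le_const) (use bound in blast)
    then have "(\<Inter>n. ?B n) \<in> null_sets ?S"
      by (intro null_setsI sets.countable_INT measurable_run_ex) (auto intro: measurable_run_ex)
    then show ?thesis
      by (rule AE_I') (auto simp: not_less)
  qed
  \<comment> \<open>Countably many levels suffice for convergence, so their null sets can be
    united.\<close>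
  have "AE \<omega> in ?S. \<forall>k::nat. \<exists>n. \<forall>i\<ge>n. V (run f x \<omega> i) < 1 / real (Suc k)"
    unfolding AE_all_countable by (intro allI AE_lt) simp
  then show ?thesis
  proof eventually_elim
    case (elim \<omega>)
    show ?case
    proof (rule LIMSEQ_I)
      fix e :: real assume "0 < e"
      then obtain k :: nat where "1 / real (Suc k) < e" using nat_approx_posE by blast
      then show "\<exists>no. \<forall>n\<ge>no. norm (V (run f x \<omega> n) - 0) < e"
        using elim V by (metis abs_of_nonneg diff_zero order.strict_trans real_norm_def)
    qed
  qed
qed

section \<open>Second-order and convexity estimates for powers\<close>

text \<open>In the binomial expansion, every term beyond the linear one carries \<open>l ^ k\<close>
  with \<open>k \<ge> 2\<close>, which is at most \<open>l\<^sup>2\<close>. What is left in absolute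
  value is the same remainder at step size 1. The proof uses a recursion for the remainder instead
  of binomial sums.\<close>

lemma power_second_order_bound:
  fixes u d l :: real
  assumes "0 \<le> l" "l \<le> 1"
  shows "\<bar>(u + l * d) ^ n - u ^ n - n * l * d * u ^ (n - 1)\<bar>
    \<le> l\<^sup>2 * ((\<bar>u\<bar> + \<bar>d\<bar>) ^ n - \<bar>u\<bar> ^ n - n * \<bar>d\<bar> * \<bar>u\<bar> ^ (n - 1))"
proof (induction n)
  case (Suc n)
  define e where "e = (u + l * d) ^ n - u ^ n - n * l * d * u ^ (n - 1)"
  define b where "b = (\<bar>u\<bar> + \<bar>d\<bar>) ^ n - \<bar>u\<bar> ^ n - n * \<bar>d\<bar> * \<bar>u\<bar> ^ (n - 1)"
  \<comment> \<open>The exponent \<open>n - 1\<close> truncates at \<open>n = 0\<close>, where the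
    factor \<open>n\<close> makes both sides vanish.\<close>
  have pw: "real n * x ^ n = real n * (x * x ^ (n - 1))" for x :: real
    by (cases n) auto
  have "(u + l * d) ^ Suc n - u ^ Suc n - Suc n * l * d * u ^ (Suc n - 1) =
      (u + l * d) * e + l\<^sup>2 * (n * d\<^sup>2 * u ^ (n - 1))"
    using pw[of u] by (auto simp: e_def algebra_simps power2_eq_square)
  also have "\<bar>\<dots>\<bar> \<le> (\<bar>u\<bar> + \<bar>d\<bar>) * \<bar>e\<bar> + l\<^sup>2 * (n * d\<^sup>2 * \<bar>u\<bar> ^ (n - 1))"
  proof (intro order_trans[OF abs_triangle_ineq] add_mono)
    have "\<bar>u + l * d\<bar> \<le> \<bar>u\<bar> + l * \<bar>d\<bar>"
      using abs_triangle_ineq[of u "l * d"] assms by (simp add: abs_mult)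
    also have "\<dots> \<le> \<bar>u\<bar> + \<bar>d\<bar>"
      using assms by (simp add: mult_left_le_one_le)
    finally show "\<bar>(u + l * d) * e\<bar> \<le> (\<bar>u\<bar> + \<bar>d\<bar>) * \<bar>e\<bar>"
      by (simp add: abs_mult mult_right_mono)
  qed (simp add: abs_mult power_abs)
  also have "\<dots> \<le> (\<bar>u\<bar> + \<bar>d\<bar>) * (l\<^sup>2 * b) + l\<^sup>2 * (n * d\<^sup>2 * \<bar>u\<bar> ^ (n - 1))"
    using Suc by (intro add_right_mono mult_left_mono) (auto simp: e_def b_def)
  also have "\<dots> = l\<^sup>2 * ((\<bar>u\<bar> + \<bar>d\<bar>) ^ Suc n - \<bar>u\<bar> ^ Suc n - Suc n * \<bar>d\<bar> * \<bar>u\<bar> ^ (Suc n - 1))"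
  proof -
    have "d\<^sup>2 = \<bar>d\<bar> * \<bar>d\<bar>" by (simp add: power2_eq_square)
    then show ?thesis using pw[of "\<bar>u\<bar>"] by (auto simp: b_def algebra_simps)
  qed
  finally show ?case .
qed simp

corollary power_second_order_le:
  fixes u d l :: real
  assumes "0 \<le> l" "l \<le> 1"
  shows "(u + l * d) ^ n \<le> u ^ n + n * l * d * u ^ (n - 1) + l\<^sup>2 * (\<bar>u\<bar> + \<bar>d\<bar>) ^ n"
proof -
  have "0 \<le> \<bar>u\<bar> ^ n" "0 \<le> n * \<bar>d\<bar> * \<bar>u\<bar> ^ (n - 1)"
    by simp_all
  then have "l\<^sup>2 * ((\<bar>u\<bar> + \<bar>d\<bar>) ^ n - \<bar>u\<bar> ^ n - n * \<bar>d\<bar> * \<bar>u\<bar> ^ (n - 1)) \<le> l\<^sup>2 * (\<bar>u\<bar> + \<bar>d\<bar>) ^ n"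
    by (intro mult_left_mono) (linarith, simp)
  then show ?thesis
    using power_second_order_bound[OF assms, of u d n] by linarith
qed

text \<open>Convexity. It turns the first-order term of the drift into a difference of
  \<open>n\<close>-th powers, to which the contraction estimate applies.\<close>

lemma even_power_above_tangent:
  fixes u v :: real
  assumes "even n"
  shows "n * u ^ (n - 1) * (v - u) \<le> v ^ n - u ^ n"
proof -
  have "convex_on UNIV (\<lambda>x::real. x ^ n)"
    using assms by (rule convex_power_even)
  moreover have "((\<lambda>x::real. x ^ n) has_real_derivative n * u ^ (n - 1)) (at u within UNIV)"
    by (auto intro!: derivative_eq_intros)
  ultimately show ?thesis
    using convex_on_imp_above_tangent[of UNIV "\<lambda>x. x ^ n" u v "n * u ^ (n - 1)"] by simp
qed

subsection \<open>Convergence of the Q-values\<close>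

text \<open>The Bellman system with finite real values, detached from strategies, so that
  differences and quotients by \<open>Qs\<close> make sense.\<close>

locale real_bellman =
  fixes A :: "'t::finite \<Rightarrow> 'a::finite set"
    and p :: "'t \<Rightarrow> 'a \<Rightarrow> 't list pmf"
    and c :: "'t \<Rightarrow> 'a \<Rightarrow> real"
    and Qs :: "'t \<times> 'a \<Rightarrow> real"
    and cs :: "'t \<Rightarrow> real"
  assumes ne: "A q \<noteq> {}"
    and fin: "a \<in> A q \<Longrightarrow> finite (set_pmf (p q a))"
    and c_pos: "a \<in> A q \<Longrightarrow> 0 < c q a"
    and cs_nonneg: "0 \<le> cs q"
    and cs_eq: "cs q = Min ((\<lambda>a. Qs (q, a)) ` A q)"
    and Qs_eq: "a \<in> A q \<Longrightarrow> Qs (q, a) = c q a + measure_pmf.expectation (p q a) (\<lambda>\<beta>. \<Sum>b\<leftarrow>\<beta>. cs b)"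
begin

section \<open>Relative errors, contraction factor and Lyapunov function\<close>

definition pairs :: "('t \<times> 'a) set" where
  "pairs = {(q, a). a \<in> A q}"

definition val :: "('t \<times> 'a \<Rightarrow> real) \<Rightarrow> 't \<Rightarrow> real" where
  "val Q q = Min ((\<lambda>a. Q (q, a)) ` A q)"

definition target :: "('t \<times> 'a \<Rightarrow> real) \<Rightarrow> 't \<times> 'a \<Rightarrow> 't list \<Rightarrow> real" where
  "target Q x \<beta> = c (fst x) (snd x) + (\<Sum>b\<leftarrow>\<beta>. val Q b)"

definition update :: "real \<Rightarrow> ('t \<times> 'a \<Rightarrow> real) \<Rightarrow> ('t \<times> 'a) \<times> 't list \<Rightarrow> 't \<times> 'a \<Rightarrow> real" where
  "update l Q s = Q(fst s := (1 - l) * Q (fst s) + l * target Q (fst s) (snd s))"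

definition err :: "('t \<times> 'a \<Rightarrow> real) \<Rightarrow> 't \<times> 'a \<Rightarrow> real" where
  "err Q x = Q x / Qs x - 1"

definition dev :: "('t \<times> 'a \<Rightarrow> real) \<Rightarrow> real" where
  "dev Q = Max ((\<lambda>x. \<bar>err Q x\<bar>) ` pairs)"

text \<open>The factor \<kappa> announced above: the largest share of \<open>Qs\<close> that is due
  to the offspring rather than to the immediate cost.\<close>

definition contr :: real where
  "contr = 1 - Min ((\<lambda>x. c (fst x) (snd x) / Qs x) ` pairs)"

definition nonneg :: "('t \<times> 'a \<Rightarrow> real) set" where
  "nonneg = {Q. \<forall>x\<in>pairs. 0 \<le> Q x}"

text \<open>A polynomial substitute for a power of \<open>dev\<close>, so that an update can be
  expanded to second order.\<close>

definition lyap :: "nat \<Rightarrow> ('t \<times> 'a \<Rightarrow> real) \<Rightarrow> real" where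
  "lyap n Q = (\<Sum>x\<in>pairs. err Q x ^ n)"

lemma pairs_nonempty [simp]: "pairs \<noteq> {}"
  using ne by (auto simp: pairs_def)

lemma fin_pairs: "x \<in> pairs \<Longrightarrow> finite (set_pmf (p (fst x) (snd x)))"
  using fin by (auto simp: pairs_def)

lemma c_pos_pairs: "x \<in> pairs \<Longrightarrow> 0 < c (fst x) (snd x)"
  using c_pos by (auto simp: pairs_def)

lemma sum_list_cs_nonneg: "0 \<le> (\<Sum>b\<leftarrow>\<beta>. cs b)"
  using cs_nonneg by (intro sum_list_nonneg) auto

lemma Qs_eq_pairs:
  "x \<in> pairs \<Longrightarrow> Qs x = c (fst x) (snd x) + measure_pmf.expectation (p (fst x) (snd x)) (\<lambda>\<beta>. \<Sum>b\<leftarrow>\<beta>. cs b)"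
  using Qs_eq by (auto simp: pairs_def)

lemma c_le_Qs: "x \<in> pairs \<Longrightarrow> c (fst x) (snd x) \<le> Qs x"
  by (simp add: Qs_eq_pairs sum_list_cs_nonneg)

lemma Qs_pos: "x \<in> pairs \<Longrightarrow> 0 < Qs x"
  using c_le_Qs c_pos_pairs by (meson less_le_trans)

lemma contr_nonneg: "0 \<le> contr"
proof -
  obtain x where x: "x \<in> pairs" using pairs_nonempty by blast
  have "Min ((\<lambda>x. c (fst x) (snd x) / Qs x) ` pairs) \<le> c (fst x) (snd x) / Qs x"
    using x by (intro Min_le) auto
  also have "\<dots> \<le> 1" using c_le_Qs[OF x] Qs_pos[OF x] by simp
  finally show ?thesis by (simp add: contr_def)
qed

lemma contr_less_1: "contr < 1"
  unfolding contr_def using c_pos_pairs Qs_pos by simp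

lemma Qs_minus_c_le: "x \<in> pairs \<Longrightarrow> Qs x - c (fst x) (snd x) \<le> contr * Qs x"
proof -
  assume x: "x \<in> pairs"
  have "1 - contr \<le> c (fst x) (snd x) / Qs x"
    unfolding contr_def using x by simp
  then show ?thesis using Qs_pos[OF x] by (simp add: field_simps)
qed

section \<open>Contraction of the Bellman operator towards its fixed point\<close>

lemma err_le_dev: "x \<in> pairs \<Longrightarrow> \<bar>err Q x\<bar> \<le> dev Q"
  unfolding dev_def by (intro Max_ge) auto

lemma dev_nonneg: "0 \<le> dev Q"
  using err_le_dev pairs_nonempty by (metis abs_ge_zero ex_in_conv order_trans)

text \<open>For the upper bound, evaluate at the action optimal for \<open>Qs\<close>. For the lower
  bound, take the action optimal for \<open>Q\<close>, whose \<open>Qs\<close>-value is at least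
  \<open>cs b\<close>.\<close>

lemma val_close:
  assumes "Q \<in> nonneg"
  shows "\<bar>val Q b - cs b\<bar> \<le> dev Q * cs b"
proof -
  have Q: "Q (b, a) = (1 + err Q (b, a)) * Qs (b, a)" "0 \<le> Q (b, a)" "\<bar>err Q (b, a)\<bar> \<le> dev Q" "0 < Qs (b, a)"
    if "a \<in> A b" for a
    using that assms Qs_pos[of "(b, a)"] err_le_dev[of "(b, a)" Q]
    by (auto simp: err_def pairs_def nonneg_def)
  have "cs b \<in> (\<lambda>a. Qs (b, a)) ` A b"
    unfolding cs_eq using ne by (intro Min_in) auto
  then obtain a where a: "a \<in> A b" "cs b = Qs (b, a)" by auto
  have "val Q b \<le> Q (b, a)"
    unfolding val_def using a by (intro Min_le) auto
  also have "\<dots> \<le> (1 + dev Q) * cs b"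
    unfolding a(2) Q(1)[OF a(1)] using Q[OF a(1)] by (intro mult_right_mono) auto
  finally have upper: "val Q b \<le> (1 + dev Q) * cs b" .
  have "val Q b \<in> (\<lambda>a. Q (b, a)) ` A b"
    unfolding val_def using ne by (intro Min_in) auto
  then obtain a' where a': "a' \<in> A b" "val Q b = Q (b, a')" by auto
  have cs_le: "cs b \<le> Qs (b, a')"
    unfolding cs_eq using a' by (intro Min_le) auto
  have "(1 - dev Q) * cs b \<le> Q (b, a')"
  \<comment> \<open>Multiplying \<open>cs_le\<close> by \<open>1 - dev Q\<close> needs a nonnegative
    factor. Otherwise the left side is nonpositive and nonnegativity of \<open>Q\<close> settles the
    claim.\<close>
  proof (cases "dev Q \<le> 1")
    case True
    then have "(1 - dev Q) * cs b \<le> (1 - dev Q) * Qs (b, a')"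
      using cs_le by (intro mult_left_mono) auto
    also have "\<dots> \<le> Q (b, a')"
      unfolding Q(1)[OF a'(1)] using Q[OF a'(1)] by (intro mult_right_mono) auto
    finally show ?thesis .
  next
    case False
    then have "(1 - dev Q) * cs b \<le> 0"
      using cs_nonneg by (intro mult_nonpos_nonneg) auto
    then show ?thesis using Q(2)[OF a'(1)] by simp
  qed
  then show ?thesis using upper a'(2) by (simp add: algebra_simps abs_le_iff)
qed

text \<open>The immediate cost cancels, so the relative error multiplies only the offspring cost.
  This is the source of the factor \<open>contr\<close>.\<close>

lemma target_close:
  assumes "Q \<in> nonneg"
  shows "\<bar>target Q x \<beta> - (c (fst x) (snd x) + (\<Sum>b\<leftarrow>\<beta>. cs b))\<bar> \<le> dev Q * (\<Sum>b\<leftarrow>\<beta>. cs b)"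
  unfolding target_def
proof (induction \<beta>)
  case (Cons b \<beta>)
  then show ?case using val_close[OF assms, of b] by (simp add: algebra_simps)
qed simp

text \<open>The Bellman operator contracts towards its fixed point \<open>Qs\<close> (though in general not between
  arbitrary points) in the maximum norm weighted by \<open>Qs\<close> itself.\<close>

lemma expected_target_contracts:
  assumes "Q \<in> nonneg" and x: "x \<in> pairs"
  shows "\<bar>measure_pmf.expectation (p (fst x) (snd x)) (\<lambda>\<beta>. target Q x \<beta>) / Qs x - 1\<bar> \<le> contr * dev Q"
proof -
  let ?P = "measure_pmf (p (fst x) (snd x))"
  have int: "integrable ?P f" for f :: "'t list \<Rightarrow> real"
    using fin_pairs[OF x] by (rule integrable_measure_pmf_finite)
  have "\<bar>(\<integral>\<beta>. target Q x \<beta> \<partial>?P) - Qs x\<bar> =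
      \<bar>\<integral>\<beta>. target Q x \<beta> - (c (fst x) (snd x) + (\<Sum>b\<leftarrow>\<beta>. cs b)) \<partial>?P\<bar>"
    using int by (simp add: Qs_eq_pairs[OF x])
  also have "\<dots> \<le> (\<integral>\<beta>. dev Q * (\<Sum>b\<leftarrow>\<beta>. cs b) \<partial>?P)"
    by (intro order_trans[OF integral_abs_bound] integral_mono int target_close assms)
  also have "\<dots> = dev Q * (Qs x - c (fst x) (snd x))"
    by (simp add: Qs_eq_pairs[OF x])
  also have "\<dots> \<le> dev Q * (contr * Qs x)"
    by (intro mult_left_mono Qs_minus_c_le x dev_nonneg)
  finally have *: "\<bar>(\<integral>\<beta>. target Q x \<beta> \<partial>?P) - Qs x\<bar> \<le> contr * dev Q * Qs x"
    by (simp add: ac_simps)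
  have "(\<integral>\<beta>. target Q x \<beta> \<partial>?P) / Qs x - 1 = ((\<integral>\<beta>. target Q x \<beta> \<partial>?P) - Qs x) / Qs x"
    using Qs_pos[OF x] by (simp add: field_simps)
  then show ?thesis
    using * Qs_pos[OF x] by (simp add: pos_divide_le_eq)
qed

text \<open>Supports are finite, so one constant serves all pairs and all possible offspring lists.
  The bound is needed for the quadratic remainder of the drift.\<close>

lemma target_linear_growth:
  obtains D where "0 \<le> D"
    and "\<And>Q x \<beta>. Q \<in> nonneg \<Longrightarrow> x \<in> pairs \<Longrightarrow> \<beta> \<in> set_pmf (p (fst x) (snd x)) \<Longrightarrow>
      \<bar>target Q x \<beta> / Qs x - 1\<bar> \<le> D * (1 + dev Q)"
proof -
  let ?I = "SIGMA x:pairs. set_pmf (p (fst x) (snd x))"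
  define r where "r = (\<lambda>(x, \<beta>). (c (fst x) (snd x) + (\<Sum>b\<leftarrow>\<beta>. cs b) + Qs x) / Qs x)"
  have "finite ?I" using fin_pairs by auto
  define D where "D = Max (r ` ?I)"
  have D: "r (x, \<beta>) \<le> D" if "x \<in> pairs" "\<beta> \<in> set_pmf (p (fst x) (snd x))" for x \<beta>
    unfolding D_def using \<open>finite ?I\<close> that by (intro Max_ge) auto
  have r0: "0 \<le> r (x, \<beta>)" if "x \<in> pairs" for x \<beta>
    using that c_pos_pairs[of x] Qs_pos[of x] sum_list_cs_nonneg[of \<beta>] by (simp add: r_def)
  obtain x \<beta> where "x \<in> pairs" "\<beta> \<in> set_pmf (p (fst x) (snd x))"
    using pairs_nonempty set_pmf_not_empty by (metis ex_in_conv)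
  then have "0 \<le> D" using D r0 order_trans by blast
  moreover have "\<bar>target Q x \<beta> / Qs x - 1\<bar> \<le> D * (1 + dev Q)"
    if "Q \<in> nonneg" and x: "x \<in> pairs" and \<beta>: "\<beta> \<in> set_pmf (p (fst x) (snd x))" for Q x \<beta>
  proof -
    let ?S = "\<Sum>b\<leftarrow>\<beta>. cs b"
    have pos: "0 < c (fst x) (snd x)" "0 < Qs x" "0 \<le> ?S"
      using c_pos_pairs[OF x] Qs_pos[OF x] sum_list_cs_nonneg by auto
    have "\<bar>target Q x \<beta> - Qs x\<bar> \<le> dev Q * ?S + (c (fst x) (snd x) + ?S + Qs x)"
      using target_close[OF that(1), of x \<beta>] pos by (simp add: abs_le_iff)
    also have "\<dots> \<le> (c (fst x) (snd x) + ?S + Qs x) * (1 + dev Q)"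
      using mult_left_mono[of ?S "c (fst x) (snd x) + ?S + Qs x" "dev Q"] pos dev_nonneg[of Q]
      by (simp add: algebra_simps)
    also have "\<dots> = r (x, \<beta>) * (1 + dev Q) * Qs x"
      using pos by (simp add: r_def)
    also have "\<dots> \<le> D * (1 + dev Q) * Qs x"
      using D[OF x \<beta>] dev_nonneg[of Q] pos by (intro mult_right_mono) auto
    finally have "\<bar>target Q x \<beta> - Qs x\<bar> / Qs x \<le> D * (1 + dev Q)"
      using pos by (simp add: pos_divide_le_eq)
    moreover have "target Q x \<beta> / Qs x - 1 = (target Q x \<beta> - Qs x) / Qs x"
      using pos by (simp add: field_simps)
    ultimately show ?thesis using pos by simp
  qed
  ultimately show thesis using that by blast
qed

section \<open>Drift of the Lyapunov function under one update\<close>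

lemma target_nonneg:
  assumes "Q \<in> nonneg" "x \<in> pairs"
  shows "0 \<le> target Q x \<beta>"
proof -
  have "0 \<le> val Q b" for b
    unfolding val_def using assms(1) ne
    by (subst Min_ge_iff) (auto simp: nonneg_def pairs_def)
  then have "0 \<le> (\<Sum>b\<leftarrow>\<beta>. val Q b)" by (intro sum_list_nonneg) auto
  then show ?thesis using c_pos_pairs[OF assms(2)] by (simp add: target_def)
qed

lemma update_nonneg:
  assumes "Q \<in> nonneg" "fst s \<in> pairs" "0 \<le> l" "l \<le> 1"
  shows "update l Q s \<in> nonneg"
  using assms target_nonneg[OF assms(1,2), of "snd s"]
  by (auto simp: nonneg_def update_def)

lemma dev_power_le_lyap:
  assumes "even n"
  shows "dev Q ^ n \<le> lyap n Q"
proof -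
  have "dev Q \<in> (\<lambda>x. \<bar>err Q x\<bar>) ` pairs"
    unfolding dev_def by (intro Max_in) auto
  then obtain x where "x \<in> pairs" "dev Q = \<bar>err Q x\<bar>" by auto
  moreover have "err Q x ^ n \<le> lyap n Q"
    unfolding lyap_def using \<open>x \<in> pairs\<close> assms by (intro member_le_sum) (auto simp: zero_le_even_power)
  ultimately show ?thesis using assms by (simp add: power_even_abs)
qed

lemma lyap_nonneg: "even n \<Longrightarrow> 0 \<le> lyap n Q"
  unfolding lyap_def by (intro sum_nonneg) (simp add: zero_le_even_power)

lemma lyap_update:
  assumes x: "x \<in> pairs"
  shows "lyap n (update l Q (x, \<beta>)) = lyap n Q - err Q x ^ n
    + (err Q x + l * ((target Q x \<beta> / Qs x - 1) - err Q x)) ^ n"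
proof -
  have "err (update l Q (x, \<beta>)) x = err Q x + l * ((target Q x \<beta> / Qs x - 1) - err Q x)"
    using Qs_pos[OF x] by (simp add: err_def update_def field_simps)
  moreover have "err (update l Q (x, \<beta>)) y = err Q y" if "y \<noteq> x" for y
    using that by (simp add: err_def update_def)
  ultimately show ?thesis
    unfolding lyap_def using x by (simp add: sum.remove[of pairs x])
qed

text \<open>Expand the one changed summand to second order, average the linear term, and apply the
  tangent inequality at the mean \<open>Ez\<close>. The contraction bounds \<open>Ez ^ n\<close> by
  \<open>contr ^ n * lyap n Q\<close>.\<close>

lemma lyap_drift_single:
  assumes "even n"
  obtains C where "0 \<le> C"
    and "\<And>Q x l. Q \<in> nonneg \<Longrightarrow> x \<in> pairs \<Longrightarrow> 0 \<le> l \<Longrightarrow> l \<le> 1 \<Longrightarrow>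
      measure_pmf.expectation (p (fst x) (snd x)) (\<lambda>\<beta>. lyap n (update l Q (x, \<beta>)))
      \<le> lyap n Q + l * (contr ^ n * lyap n Q - err Q x ^ n) + C * l\<^sup>2 * (1 + lyap n Q)"
proof -
  obtain D where D: "0 \<le> D" and growth: "\<And>Q x \<beta>. Q \<in> nonneg \<Longrightarrow> x \<in> pairs \<Longrightarrow>
      \<beta> \<in> set_pmf (p (fst x) (snd x)) \<Longrightarrow> \<bar>target Q x \<beta> / Qs x - 1\<bar> \<le> D * (1 + dev Q)"
    using target_linear_growth by blast
  \<comment> \<open>Chosen for \<open>remainder\<close> below, where the base of the power is at
    most \<open>2 * (D + 2) * max 1 (dev Q)\<close>.\<close>
  define C where "C = (2 * (D + 2)) ^ n"
  have "measure_pmf.expectation (p (fst x) (snd x)) (\<lambda>\<beta>. lyap n (update l Q (x, \<beta>)))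
      \<le> lyap n Q + l * (contr ^ n * lyap n Q - err Q x ^ n) + C * l\<^sup>2 * (1 + lyap n Q)"
    if Q: "Q \<in> nonneg" and x: "x \<in> pairs" and l: "0 \<le> l" "l \<le> 1" for Q x l
  proof -
    let ?P = "measure_pmf (p (fst x) (snd x))"
    define e where "e = err Q x"
    define z where "z \<beta> = target Q x \<beta> / Qs x - 1" for \<beta>
    define Ez where "Ez = (\<integral>\<beta>. target Q x \<beta> \<partial>?P) / Qs x - 1"
    have int: "integrable ?P f" for f :: "'t list \<Rightarrow> real"
      using fin_pairs[OF x] by (rule integrable_measure_pmf_finite)
    have remainder: "(\<bar>e\<bar> + \<bar>z \<beta> - e\<bar>) ^ n \<le> C * (1 + lyap n Q)"
      if "\<beta> \<in> set_pmf (p (fst x) (snd x))" for \<beta>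
    proof -
      have "\<bar>e\<bar> + \<bar>z \<beta> - e\<bar> \<le> 2 * dev Q + D * (1 + dev Q)"
        using growth[OF Q x that] err_le_dev[OF x, of Q] unfolding z_def e_def by linarith
      also have "\<dots> \<le> (D + 2) * (2 * max 1 (dev Q))"
      proof -
        have "2 * dev Q + D * (1 + dev Q) \<le> (D + 2) * (1 + dev Q)"
          by (simp add: algebra_simps)
        also have "\<dots> \<le> (D + 2) * (2 * max 1 (dev Q))"
          using D by (intro mult_left_mono) auto
        finally show ?thesis .
      qed
      finally have "(\<bar>e\<bar> + \<bar>z \<beta> - e\<bar>) ^ n \<le> ((D + 2) * (2 * max 1 (dev Q))) ^ n"
        by (intro power_mono) auto
      also have "\<dots> = C * max 1 (dev Q) ^ n"
        by (simp add: C_def flip: power_mult_distrib) (simp add: algebra_simps)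
      also have "\<dots> \<le> C * (1 + lyap n Q)"
      proof (intro mult_left_mono)
        show "max 1 (dev Q) ^ n \<le> 1 + lyap n Q"
          using dev_power_le_lyap[OF assms, of Q] lyap_nonneg[OF assms, of Q]
          by (auto simp: max_def)
      qed (use D in \<open>simp add: C_def\<close>)
      finally show ?thesis .
    qed
    \<comment> \<open>The upper bound is affine in \<open>z \<beta>\<close>, so its expectation sees
      the sampled target only through its mean.\<close>
    have "(\<integral>\<beta>. lyap n (update l Q (x, \<beta>)) \<partial>?P) \<le>
        (\<integral>\<beta>. (lyap n Q - n * l * e * e ^ (n - 1) + C * l\<^sup>2 * (1 + lyap n Q)) + n * l * e ^ (n - 1) * z \<beta> \<partial>?P)"
    proof (intro integral_mono_AE int AE_pmfI)
      fix \<beta> assume "\<beta> \<in> set_pmf (p (fst x) (snd x))"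
      then have "l\<^sup>2 * (\<bar>e\<bar> + \<bar>z \<beta> - e\<bar>) ^ n \<le> l\<^sup>2 * (C * (1 + lyap n Q))"
        by (intro mult_left_mono remainder) auto
      then show "lyap n (update l Q (x, \<beta>)) \<le>
          (lyap n Q - n * l * e * e ^ (n - 1) + C * l\<^sup>2 * (1 + lyap n Q)) + n * l * e ^ (n - 1) * z \<beta>"
        using power_second_order_le[OF l, of e "z \<beta> - e" n]
        unfolding lyap_update[OF x] e_def[symmetric] z_def[symmetric] by (simp add: algebra_simps)
    qed
    also have "\<dots> = lyap n Q - n * l * e * e ^ (n - 1) + C * l\<^sup>2 * (1 + lyap n Q) + n * l * e ^ (n - 1) * Ez"
      using int by (simp add: z_def Ez_def)
    also have "\<dots> = lyap n Q + l * (n * e ^ (n - 1) * (Ez - e)) + C * l\<^sup>2 * (1 + lyap n Q)"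
      by (simp add: algebra_simps)
    also have "\<dots> \<le> lyap n Q + l * (contr ^ n * lyap n Q - e ^ n) + C * l\<^sup>2 * (1 + lyap n Q)"
    proof (intro add_right_mono add_left_mono mult_left_mono)
      have "Ez ^ n \<le> (contr * dev Q) ^ n"
        using expected_target_contracts[OF Q x] power_mono[of "\<bar>Ez\<bar>" "contr * dev Q" n] assms
        by (simp add: Ez_def power_even_abs)
      also have "\<dots> \<le> contr ^ n * lyap n Q"
        unfolding power_mult_distrib using contr_nonneg
        by (intro mult_left_mono dev_power_le_lyap assms) auto
      finally show "n * e ^ (n - 1) * (Ez - e) \<le> contr ^ n * lyap n Q - e ^ n"
        using even_power_above_tangent[OF assms, of e Ez] by linarith
    qed (use l in auto)
    finally show ?thesis by (simp add: e_def)
  qed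
  moreover have "0 \<le> C" using D by (simp add: C_def)
  ultimately show thesis using that by blast
qed

lemma set_sample_pmf: "s \<in> set_pmf (sample_pmf sel p) \<Longrightarrow> fst s \<in> set_pmf sel"
  by (auto simp: sample_pmf_def)

text \<open>Each summand is selected with probability at least \<open>pmin\<close>, so to first
  order in \<open>l\<close> the loss is at least \<open>pmin * lyap n Q\<close>. The gain is at most
  \<open>contr ^ n * lyap n Q\<close>, which the choice of \<open>n\<close> limits to half of that
  loss.\<close>

lemma lyap_drift:
  assumes n: "even n" "contr ^ n \<le> pmin / 2"
    and sel: "set_pmf sel \<subseteq> pairs" "\<And>x. x \<in> pairs \<Longrightarrow> pmin \<le> pmf sel x"
  obtains C where "0 \<le> C"
    and "\<And>Q l. Q \<in> nonneg \<Longrightarrow> 0 \<le> l \<Longrightarrow> l \<le> 1 \<Longrightarrow>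
      (\<integral>\<^sup>+s. ennreal (lyap n (update l Q s)) \<partial>measure_pmf (sample_pmf sel p))
      \<le> ennreal ((1 - pmin / 2 * l + C * l\<^sup>2) * lyap n Q + C * l\<^sup>2)"
proof -
  obtain C where C: "0 \<le> C" and single: "\<And>Q x l. Q \<in> nonneg \<Longrightarrow> x \<in> pairs \<Longrightarrow> 0 \<le> l \<Longrightarrow> l \<le> 1 \<Longrightarrow>
      measure_pmf.expectation (p (fst x) (snd x)) (\<lambda>\<beta>. lyap n (update l Q (x, \<beta>)))
      \<le> lyap n Q + l * (contr ^ n * lyap n Q - err Q x ^ n) + C * l\<^sup>2 * (1 + lyap n Q)"
    using lyap_drift_single[OF n(1)] by blast
  have "(\<integral>\<^sup>+s. ennreal (lyap n (update l Q s)) \<partial>measure_pmf (sample_pmf sel p))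
      \<le> ennreal ((1 - pmin / 2 * l + C * l\<^sup>2) * lyap n Q + C * l\<^sup>2)"
    if Q: "Q \<in> nonneg" and l: "0 \<le> l" "l \<le> 1" for Q l
  proof -
    let ?V = "lyap n Q"
    have finK: "finite (set_pmf (sample_pmf sel p))"
      using sel(1) fin_pairs by (auto simp: sample_pmf_def)
    have "measure_pmf.expectation (sample_pmf sel p) (\<lambda>s. lyap n (update l Q s)) =
        (\<Sum>x\<in>pairs. pmf sel x * measure_pmf.expectation (p (fst x) (snd x)) (\<lambda>\<beta>. lyap n (update l Q (x, \<beta>))))"
      unfolding sample_pmf_def
      by (subst pmf_expectation_bind[of pairs]) (use sel(1) fin_pairs in auto)
    also have "\<dots> \<le> (\<Sum>x\<in>pairs. pmf sel x * (?V + l * (contr ^ n * ?V - err Q x ^ n) + C * l\<^sup>2 * (1 + ?V)))"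
      by (intro sum_mono mult_left_mono single Q l) auto
    also have "\<dots> = (\<Sum>x\<in>pairs. pmf sel x) * (?V + l * contr ^ n * ?V + C * l\<^sup>2 * (1 + ?V))
        - l * (\<Sum>x\<in>pairs. pmf sel x * err Q x ^ n)"
      unfolding sum_distrib_left sum_distrib_right sum_subtractf[symmetric]
      by (intro sum.cong) (auto simp: algebra_simps)
    also have "\<dots> = ?V + l * (contr ^ n * ?V) + C * l\<^sup>2 * (1 + ?V) - l * (\<Sum>x\<in>pairs. pmf sel x * err Q x ^ n)"
      using sel(1) by (simp add: sum_pmf_eq_1)
    also have "\<dots> \<le> ?V + l * (pmin / 2 * ?V) + C * l\<^sup>2 * (1 + ?V) - l * (pmin * ?V)"
    proof (intro diff_mono add_mono mult_left_mono mult_right_mono)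
      show "pmin * ?V \<le> (\<Sum>x\<in>pairs. pmf sel x * err Q x ^ n)"
        unfolding lyap_def sum_distrib_left using n(1) sel(2)
        by (intro sum_mono mult_right_mono) (auto simp: zero_le_even_power)
    qed (use l n C lyap_nonneg in auto)
    also have "\<dots> = (1 - pmin / 2 * l + C * l\<^sup>2) * ?V + C * l\<^sup>2"
      by (simp add: algebra_simps)
    finally show ?thesis
      using finK lyap_nonneg[OF n(1)]
      by (subst nn_integral_eq_integral) (auto intro!: integrable_measure_pmf_finite ennreal_leI)
  qed
  then show thesis using that C by blast
qed

section \<open>Almost sure convergence of the Q-values in the real Bellman system\<close>

lemma qlearn_eq_run: "qlearn A c lr Q0 \<omega> i = run (\<lambda>i. update (lr i)) Q0 \<omega> i"
  by (induction i) (auto simp: update_def target_def val_def split: prod.splits)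

theorem qlearn_tendsto:
  assumes lr: "\<And>i. 0 \<le> lr i" "\<And>i. lr i \<le> 1" "\<not> summable lr" "summable (\<lambda>i. (lr i)\<^sup>2)"
    and sel: "set_pmf sel \<subseteq> pairs" "\<And>x. x \<in> pairs \<Longrightarrow> pmin \<le> pmf sel x" and "0 < pmin"
    and Q0: "Q0 \<in> nonneg"
  shows "AE \<omega> in stream_space (measure_pmf (sample_pmf sel p)).
    \<forall>x\<in>pairs. (\<lambda>i. qlearn A c lr Q0 \<omega> i x) \<longlonglongrightarrow> Qs x"
proof -
  obtain x where "x \<in> pairs" using pairs_nonempty by blast
  then have "pmin \<le> 1" using sel(2) pmf_le_1 order_trans by metis
  obtain k where k: "contr ^ k < pmin / 2"
    using real_arch_pow_inv[of "pmin / 2" contr] \<open>0 < pmin\<close> contr_less_1 by auto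
  \<comment> \<open>Doubling makes the exponent even, and raising it can only decrease the power of
    \<open>contr\<close>.\<close>
  define n where "n = 2 * k"
  \<comment> \<open>\<open>k = 0\<close> would give \<open>1 < pmin / 2\<close>. A positive exponent
    is needed for the \<open>n\<close>-th root at the end.\<close>
  have "0 < k" using k \<open>pmin \<le> 1\<close> by (intro gr0I) auto
  have "contr ^ n \<le> contr ^ k"
    unfolding n_def using contr_nonneg contr_less_1 by (intro power_decreasing) auto
  then have n: "even n" "contr ^ n \<le> pmin / 2" "0 < n"
    using k \<open>0 < k\<close> by (auto simp: n_def)
  obtain C where C: "0 \<le> C" and drift: "\<And>Q l. Q \<in> nonneg \<Longrightarrow> 0 \<le> l \<Longrightarrow> l \<le> 1 \<Longrightarrow>
      (\<integral>\<^sup>+s. ennreal (lyap n (update l Q s)) \<partial>measure_pmf (sample_pmf sel p))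
      \<le> ennreal ((1 - pmin / 2 * l + C * l\<^sup>2) * lyap n Q + C * l\<^sup>2)"
    using lyap_drift[OF n(1,2) sel] by blast
  have "AE \<omega> in stream_space (measure_pmf (sample_pmf sel p)).
      (\<lambda>i. lyap n (run (\<lambda>i. update (lr i)) Q0 \<omega> i)) \<longlonglongrightarrow> 0"
  proof (rule run_Lyapunov_tendsto_0[where I=nonneg and \<delta>="pmin / 2" and lr=lr and C=C])
    fix i Q s assume "Q \<in> nonneg" "s \<in> set_pmf (sample_pmf sel p)"
    then show "update (lr i) Q s \<in> nonneg"
      using set_sample_pmf[of s sel] sel(1) lr by (intro update_nonneg) auto
  qed (use lr C Q0 n \<open>0 < pmin\<close> \<open>pmin \<le> 1\<close> lyap_nonneg drift in auto)
  then show ?thesis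
  proof eventually_elim
    case (elim \<omega>)
    define X where "X i = run (\<lambda>i. update (lr i)) Q0 \<omega> i" for i
    show ?case
      unfolding qlearn_eq_run X_def[symmetric]
    proof
      fix x assume x: "x \<in> pairs"
      have "(\<lambda>i. err (X i) x ^ n) \<longlonglongrightarrow> 0"
      proof (rule tendsto_sandwich[where f="\<lambda>_. 0"])
        show "\<forall>\<^sub>F i in sequentially. err (X i) x ^ n \<le> lyap n (X i)"
          unfolding lyap_def using x n(1) by (intro always_eventually allI member_le_sum) (auto simp: zero_le_even_power)
        show "(\<lambda>i. lyap n (X i)) \<longlonglongrightarrow> 0" using elim by (simp add: X_def)
      qed (use n in \<open>auto simp: zero_le_even_power\<close>)
      \<comment> \<open>As \<open>n\<close> is even, the power equals that of the absolute value,
        and its root recovers the absolute error.\<close>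
      then have "(\<lambda>i. root n (\<bar>err (X i) x\<bar> ^ n)) \<longlonglongrightarrow> root n 0"
        using n(1) by (intro tendsto_real_root) (simp add: power_even_abs)
      then have "(\<lambda>i. err (X i) x) \<longlonglongrightarrow> 0"
        using n(3) by (simp add: real_root_power_cancel tendsto_rabs_zero_iff)
      then have "(\<lambda>i. (err (X i) x + 1) * Qs x) \<longlonglongrightarrow> (0 + 1) * Qs x"
        by (intro tendsto_intros)
      then show "(\<lambda>i. X i x) \<longlonglongrightarrow> Qs x"
        using Qs_pos[OF x] by (simp add: err_def)
    qed
  qed
qed

end

section \<open>Transfer to the extended-real optimal costs\<close>

lemma tendsto_Min_image:
  fixes f :: "'b \<Rightarrow> 'a \<Rightarrow> real"
  assumes "finite S" "S \<noteq> {}" "\<And>a. a \<in> S \<Longrightarrow> ((\<lambda>i. f i a) \<longlongrightarrow> g a) F"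
  shows "((\<lambda>i. Min (f i ` S)) \<longlongrightarrow> Min (g ` S)) F"
  using assms
proof (induction S rule: finite_ne_induct)
  case (insert a S)
  then show ?case by (auto intro!: tendsto_min)
qed simp

text \<open>All \<open>Qstar\<close> values of enabled pairs are finite, hence so is their minimum
  \<open>opt_cost\<close>, and passing to reals loses nothing. The two equations of the locale come
  from the Bellman equation and the definition of \<open>Qstar\<close>.\<close>

lemma real_bellman_opt:
  fixes A :: "'t::finite \<Rightarrow> 'a::finite set"
  assumes B: "bmdp A p c" and fin: "\<And>q a. a \<in> A q \<Longrightarrow> Qstar A p c q a < \<infinity>"
  shows "real_bellman A p c (\<lambda>(q, a). enn2real (Qstar A p c q a)) (\<lambda>q. enn2real (opt_cost A p c q))"
proof -
  have ne: "A q \<noteq> {}" and finp: "a \<in> A q \<Longrightarrow> finite (set_pmf (p q a))" and cpos: "a \<in> A q \<Longrightarrow> 0 < c q a" for q a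
    using B by (auto simp: bmdp_def)
  have Qstar: "Qstar A p c q a = qval p c (opt_cost A p c) q a" for q a
    by (simp add: Qstar_def qval_def)
  have opt: "opt_cost A p c q = Min (Qstar A p c q ` A q)" for q
  proof -
    have "opt_cost A p c q = (INF a\<in>A q. Qstar A p c q a)"
      by (subst opt_cost_eq_bellman[OF B]) (simp add: bellman_def Qstar)
    also have "\<dots> = Min (Qstar A p c q ` A q)"
      using ne by (intro cInf_eq_Min) auto
    finally show ?thesis .
  qed
  have opt_fin: "opt_cost A p c q < \<infinity>" for q
    unfolding opt using ne[of q] fin by (subst Min_less_iff) auto
  then have opt_real: "opt_cost A p c q = ennreal (enn2real (opt_cost A p c q))" for q
    by (simp add: less_top)
  have list_nonneg: "0 \<le> (\<Sum>b\<leftarrow>\<beta>. enn2real (opt_cost A p c b))" for \<beta>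
    by (intro sum_list_nonneg) auto
  have list_real: "(\<Sum>b\<leftarrow>\<beta>. opt_cost A p c b) = ennreal (\<Sum>b\<leftarrow>\<beta>. enn2real (opt_cost A p c b))" for \<beta>
  proof (induction \<beta>)
    case (Cons b \<beta>)
    then show ?case
      using list_nonneg[of \<beta>] opt_real[of b] by simp
  qed simp
  show ?thesis
  proof
    fix q
    \<comment> \<open>\<open>enn2real\<close> sends infinity to 0 and is monotone only below it, so
      finiteness is what lets it commute with \<open>Min\<close>.\<close>
    have "enn2real (Min (Qstar A p c q ` A q)) = Min (enn2real ` Qstar A p c q ` A q)"
    proof (rule Min_eqI[symmetric])
      show "enn2real (Min (Qstar A p c q ` A q)) \<in> enn2real ` Qstar A p c q ` A q"
        using ne by (intro imageI Min_in) auto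
    qed (use fin in \<open>auto intro!: enn2real_mono Min_le\<close>)
    then show "enn2real (opt_cost A p c q) = Min ((\<lambda>a. case (q, a) of (q, a) \<Rightarrow> enn2real (Qstar A p c q a)) ` A q)"
      by (simp add: opt image_image)
  next
    fix q a assume a: "a \<in> A q"
    have "Qstar A p c q a = ennreal (c q a) + ennreal (\<integral>\<beta>. (\<Sum>b\<leftarrow>\<beta>. enn2real (opt_cost A p c b)) \<partial>measure_pmf (p q a))"
      unfolding Qstar_def list_real
      by (subst nn_integral_eq_integral)
        (auto intro!: integrable_measure_pmf_finite finp[OF a] list_nonneg)
    then show "(case (q, a) of (q, a) \<Rightarrow> enn2real (Qstar A p c q a)) =
        c q a + measure_pmf.expectation (p q a) (\<lambda>\<beta>. \<Sum>b\<leftarrow>\<beta>. enn2real (opt_cost A p c b))"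
      using cpos[OF a] by (simp add: list_nonneg flip: ennreal_plus)
  qed (use ne finp cpos in auto)
qed

theorem theorem6:
  fixes A :: "'t::finite \<Rightarrow> 'a::finite set"
    and p :: "'t \<Rightarrow> 'a \<Rightarrow> 't list pmf"
    and c :: "'t \<Rightarrow> 'a \<Rightarrow> real"
    and lr :: "nat \<Rightarrow> real"
    and sel :: "('t \<times> 'a) pmf"
    and pmin :: real
    and Q0 :: "'t \<times> 'a \<Rightarrow> real"
  assumes "bmdp A p c"
    and "\<And>q a. a \<in> A q \<Longrightarrow> Qstar A p c q a < \<infinity>"
    and "\<And>i. 0 \<le> lr i \<and> lr i \<le> 1"
    and "\<not> summable lr"
    and "summable (\<lambda>i. (lr i)\<^sup>2)"
    and "set_pmf sel \<subseteq> {(q, a). a \<in> A q}"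
    and "pmin > 0"
    and "\<And>q a. a \<in> A q \<Longrightarrow> pmf sel (q, a) \<ge> pmin"
    and "\<And>q a. a \<in> A q \<Longrightarrow> Q0 (q, a) \<ge> 0"
  shows "AE \<omega> in stream_space (measure_pmf (sample_pmf sel p)).
           (\<forall>q. \<forall>a\<in>A q. (\<lambda>i. qlearn A c lr Q0 \<omega> i (q, a)) \<longlonglongrightarrow> enn2real (Qstar A p c q a)) \<and>
           (\<forall>q. (\<lambda>i. Min ((\<lambda>a. qlearn A c lr Q0 \<omega> i (q, a)) ` A q)) \<longlonglongrightarrow> enn2real (opt_cost A p c q))"
proof -
  interpret real_bellman A p c "\<lambda>(q, a). enn2real (Qstar A p c q a)" "\<lambda>q. enn2real (opt_cost A p c q)"
    using assms(1,2) by (rule real_bellman_opt)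
  have "AE \<omega> in stream_space (measure_pmf (sample_pmf sel p)).
    \<forall>x\<in>pairs. (\<lambda>i. qlearn A c lr Q0 \<omega> i x) \<longlonglongrightarrow> (\<lambda>(q, a). enn2real (Qstar A p c q a)) x"
    by (rule qlearn_tendsto) (use assms in \<open>auto simp: pairs_def nonneg_def\<close>)
  then show ?thesis
  proof eventually_elim
    case (elim \<omega>)
    then have lim: "(\<lambda>i. qlearn A c lr Q0 \<omega> i (q, a)) \<longlonglongrightarrow> enn2real (Qstar A p c q a)" if "a \<in> A q" for q a
      using that by (auto simp: pairs_def)
    moreover have "(\<lambda>i. Min ((\<lambda>a. qlearn A c lr Q0 \<omega> i (q, a)) ` A q)) \<longlonglongrightarrow> enn2real (opt_cost A p c q)" for q
      \<comment> \<open>The Bellman equation writes the limit as the minimum of the limits of the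
        individual Q-values.\<close>
      unfolding cs_eq[of q] using ne lim by (intro tendsto_Min_image) auto
    ultimately show ?case by blast
  qed
qed

end
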